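(* Let $\Omega\subseteq\mathbb{R}^m$ be closed, $B\subseteq\mathbb{R}^d$ be closed and convex, and let the transportation cost be $c(u,w)=\|u-w\|_q^2$ on $\Omega\times\Omega$. Assume that the loss $\ell:\Omega\times B\to\mathbb{R}$ is continuous and non-negative, that $\ell(x,\cdot)$ is convex for each $x$, and that $\beta\mapsto E_{P_*}\{\ell(X,\beta)\}$ has a unique minimizer $\beta_*$ over $B$, with $\beta_*\in B^\circ$ (the interior of $B$). Then for any $\delta>0$, $$\inf_{\beta\in B}\ \sup_{P\in\mathcal{U}_\delta(P_n)}E_P\{\ell(X;\beta)\}=\sup_{P\in\mathcal{U}_\delta(P_n)}\ \inf_{\beta\in B}E_P\{\ell(X;\beta)\},$$ and there exists a distributionally robust estimator choice $\beta_n^{DRO}(\delta)\in\arg\min_{\beta\in B}\sup_{P\in\mathcal{U}_\delta(P_n)}E_P\{\ell(X;\beta)\}$ such that $\beta_n^{DRO}(\delta)\in\Lambda^+_\delta(P_n)$.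
   Context: $X_1,\dots,X_n$ are i.i.d. samples from a distribution $P_*$ on $\Omega$ and $P_n=n^{-1}\sum_{i=1}^n\delta_{X_i}$ is the empirical measure. $E_P$ denotes expectation when $X\sim P$. $\mathcal{P}(\Omega)$ is the set of probability distributions on $\Omega$; $q\in[1,\infty]$. $D_c(P,Q)=\min_{\pi\in\Pi(P,Q)}E_\pi\{c(X,Y)\}$, where $\Pi(P,Q)$ is the set of couplings of $P$ and $Q$; $W(P,Q)=D_c(P,Q)^{1/2}$; $\mathcal{U}_\delta(P_n)=\{P\in\mathcal{P}(\Omega):W(P_n,P)\le\delta^{1/2}\}$. $\Lambda_\delta(P_n)=\{\beta\in B:\beta\in\arg\min_{b\in B}E_P\{\ell(X;b)\}\text{ for some }P\in\mathcal{U}_\delta(P_n)\}$ and $\Lambda^+_\delta(P_n)=\mathrm{cl}\{\cap_{\epsilon>0}\Lambda_{\delta+\epsilon}(P_n)\}$, where $\mathrm{cl}$ denotes closure. *)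

theory Defs
  imports "HOL-Probability.Probability"
begin

abbreviation borel_on :: "'a::topological_space set \<Rightarrow> 'a measure" where
  "borel_on \<Omega> \<equiv> restrict_space borel \<Omega>"

definition prob_dists :: "'a::topological_space set \<Rightarrow> 'a measure set" where
  "prob_dists \<Omega> = {P. prob_space P \<and> sets P = sets (borel_on \<Omega>)}"

definition lq_norm :: "ereal \<Rightarrow> real ^ 'm \<Rightarrow> real" where
  "lq_norm q u =
     (if q = \<infinity> then infnorm u
      else (\<Sum>i\<in>UNIV. \<bar>u $ i\<bar> powr real_of_ereal q) powr (1 / real_of_ereal q))"

definition couplings ::
  "'a::topological_space set \<Rightarrow> 'a measure \<Rightarrow> 'a measure \<Rightarrow> ('a \<times> 'a) measure set" where
  "couplings \<Omega> P Q =
     {\<pi>. prob_space \<pi> \<and> sets \<pi> = sets (borel_on \<Omega> \<Otimes>\<^sub>M borel_on \<Omega>)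
        \<and> distr \<pi> (borel_on \<Omega>) fst = P \<and> distr \<pi> (borel_on \<Omega>) snd = Q}"

text \<open>The costs below are continuous and non-negative and \<open>\<Omega>\<close> is closed, so the infimum over
  couplings is a minimum; it may be infinite.\<close>

definition transport_cost ::
  "('a \<Rightarrow> 'a \<Rightarrow> real) \<Rightarrow> 'a::topological_space set \<Rightarrow> 'a measure \<Rightarrow> 'a measure \<Rightarrow> ennreal" where
  "transport_cost c \<Omega> P Q = (INF \<pi>\<in>couplings \<Omega> P Q. \<integral>\<^sup>+ z. ennreal (c (fst z) (snd z)) \<partial>\<pi>)"

definition sqrt_ennreal :: "ennreal \<Rightarrow> ennreal" where
  "sqrt_ennreal t = (if t = \<infinity> then \<infinity> else ennreal (sqrt (enn2real t)))"

definition wasserstein ::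
  "('a \<Rightarrow> 'a \<Rightarrow> real) \<Rightarrow> 'a::topological_space set \<Rightarrow> 'a measure \<Rightarrow> 'a measure \<Rightarrow> ennreal" where
  "wasserstein c \<Omega> P Q = sqrt_ennreal (transport_cost c \<Omega> P Q)"

definition uncertainty ::
  "('a \<Rightarrow> 'a \<Rightarrow> real) \<Rightarrow> 'a::topological_space set \<Rightarrow> real \<Rightarrow> 'a measure \<Rightarrow> 'a measure set" where
  "uncertainty c \<Omega> \<delta> Q = {P \<in> prob_dists \<Omega>. wasserstein c \<Omega> Q P \<le> ennreal (sqrt \<delta>)}"

text \<open>Only used for non-negative losses, whose expectation is well defined in \<open>[0, \<infinity>]\<close>.\<close>

definition expected_loss :: "('a \<Rightarrow> 'b \<Rightarrow> real) \<Rightarrow> 'a measure \<Rightarrow> 'b \<Rightarrow> ennreal" where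
  "expected_loss l P \<beta> = (\<integral>\<^sup>+ x. ennreal (l x \<beta>) \<partial>P)"

definition robust_loss ::
  "('a \<Rightarrow> 'a \<Rightarrow> real) \<Rightarrow> 'a::topological_space set \<Rightarrow> ('a \<Rightarrow> 'b \<Rightarrow> real) \<Rightarrow> real \<Rightarrow> 'a measure
     \<Rightarrow> 'b \<Rightarrow> ennreal" where
  "robust_loss c \<Omega> l \<delta> Q \<beta> = (SUP P\<in>uncertainty c \<Omega> \<delta> Q. expected_loss l P \<beta>)"

definition argmin_on :: "'b set \<Rightarrow> ('b \<Rightarrow> 'c::order) \<Rightarrow> 'b set" where
  "argmin_on B f = {\<beta>. is_arg_min f (\<lambda>b. b \<in> B) \<beta>}"

definition compatible_estimators ::
  "('a \<Rightarrow> 'a \<Rightarrow> real) \<Rightarrow> 'a::topological_space set \<Rightarrow> ('a \<Rightarrow> 'b \<Rightarrow> real) \<Rightarrow> 'b set \<Rightarrow> real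
     \<Rightarrow> 'a measure \<Rightarrow> 'b set" where
  "compatible_estimators c \<Omega> l B \<delta> Q =
     {\<beta> \<in> B. \<exists>P\<in>uncertainty c \<Omega> \<delta> Q. \<beta> \<in> argmin_on B (expected_loss l P)}"

definition compatible_estimators_plus ::
  "('a \<Rightarrow> 'a \<Rightarrow> real) \<Rightarrow> 'a::topological_space set \<Rightarrow> ('a \<Rightarrow> 'b::topological_space \<Rightarrow> real) \<Rightarrow> 'b set
     \<Rightarrow> real \<Rightarrow> 'a measure \<Rightarrow> 'b set" where
  "compatible_estimators_plus c \<Omega> l B \<delta> Q =
     closure (\<Inter>\<epsilon>\<in>{0<..}. compatible_estimators c \<Omega> l B (\<delta> + \<epsilon>) Q)"

definition empirical_measure :: "'a::topological_space set \<Rightarrow> nat \<Rightarrow> (nat \<Rightarrow> 'a) \<Rightarrow> 'a measure" where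
  "empirical_measure \<Omega> n x =
     measure_of \<Omega> (sets (borel_on \<Omega>))
       (\<lambda>A. (\<Sum>i=1..n. emeasure (return (borel_on \<Omega>) (x i)) A) / of_nat n)"

lemma space_empirical_measure [simp]: "space (empirical_measure \<Omega> n x) = \<Omega>"
  and sets_empirical_measure [simp, measurable_cong]:
    "sets (empirical_measure \<Omega> n x) = sets (borel_on \<Omega>)"
proof -
  have "sets (borel_on \<Omega>) \<subseteq> Pow \<Omega>"
    by (metis sets.space_closed space_restrict_space2 space_restrict_space space_borel Int_UNIV_right)
  moreover have "sigma_sets \<Omega> (sets (borel_on \<Omega>)) = sets (borel_on \<Omega>)"
    using sets.sigma_sets_eq[of "borel_on \<Omega>"] by (simp add: space_restrict_space)
  ultimately show "space (empirical_measure \<Omega> n x) = \<Omega>"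
    "sets (empirical_measure \<Omega> n x) = sets (borel_on \<Omega>)"
    unfolding empirical_measure_def by (simp_all add: space_measure_of sets_measure_of)
qed

lemma emeasure_empirical_measure:
  assumes A: "A \<in> sets (borel_on \<Omega>)"
  shows "emeasure (empirical_measure \<Omega> n x) A =
    (\<Sum>i=1..n. emeasure (return (borel_on \<Omega>) (x i)) A) / of_nat n"
proof (rule emeasure_measure_of[OF empirical_measure_def])
  show "sets (borel_on \<Omega>) \<subseteq> Pow \<Omega>"
    by (metis sets.space_closed space_restrict_space space_borel Int_UNIV_right)
  show "A \<in> sets (empirical_measure \<Omega> n x)"
    using A by simp
  show "positive (sets (empirical_measure \<Omega> n x))
     (\<lambda>A. (\<Sum>i=1..n. emeasure (return (borel_on \<Omega>) (x i)) A) / of_nat n)"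
    by (simp add: positive_def)
  show "countably_additive (sets (empirical_measure \<Omega> n x))
     (\<lambda>A. (\<Sum>i=1..n. emeasure (return (borel_on \<Omega>) (x i)) A) / of_nat n)"
  proof (rule countably_additiveI)
    fix F :: "nat \<Rightarrow> 'a set"
    assume F: "range F \<subseteq> sets (empirical_measure \<Omega> n x)" "disjoint_family F"
    have "(\<Sum>k. (\<Sum>i=1..n. emeasure (return (borel_on \<Omega>) (x i)) (F k)) / of_nat n)
        = (\<Sum>k. \<Sum>i=1..n. emeasure (return (borel_on \<Omega>) (x i)) (F k)) / of_nat n"
      by (simp add: divide_ennreal_def)
    also have "(\<Sum>k. \<Sum>i=1..n. emeasure (return (borel_on \<Omega>) (x i)) (F k))
        = (\<Sum>i=1..n. \<Sum>k. emeasure (return (borel_on \<Omega>) (x i)) (F k))"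
      by (rule suminf_sum) simp
    also have "\<dots> = (\<Sum>i=1..n. emeasure (return (borel_on \<Omega>) (x i)) (\<Union>k. F k))"
      using F by (intro sum.cong refl suminf_emeasure) simp_all
    finally show "(\<Sum>k. (\<Sum>i=1..n. emeasure (return (borel_on \<Omega>) (x i)) (F k)) / of_nat n)
        = (\<Sum>i=1..n. emeasure (return (borel_on \<Omega>) (x i)) (\<Union>k. F k)) / of_nat n" .
  qed
qed

end

theory Submission
  imports Defs
begin

text \<open>The starting point is a pointwise consequence of the uniqueness of \<open>\<beta>star\<close>: 
every other \<open>\<beta> \<in> B\<close> is strictly worse than \<open>\<beta>star\<close> at some point \<open>x \<in> \<Omega>\<close>
(otherwise \<open>\<beta>\<close> would minimize the expected loss as well). The unit sphere about \<open>\<beta>star\<close> being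
compact, finitely many points \<open>x\<close> suffice on it, and convexity propagates the strict increase
along rays: the losses at these points are jointly coercive on \<open>B\<close>
(\<open>finite_coercive_subfamily\<close>). Since \<open>\<delta> > 0\<close>, a small amount of the mass of the empirical measure
can be moved to these points, so for every sample the uncertainty set contains a distribution
whose expected loss has bounded sublevel sets.

The uncertainty set may be replaced by the finitely supported transport plans leaving the empirical
measure with cost at most \<open>\<delta>\<close>. Each such plan yields a distribution in the uncertainty set, and
conversely plans approximate the expected loss of any such distribution from below
(\<open>expected_loss_approx_by_finite_plan\<close>): take a coupling of cost slightly above \<open>\<delta>\<close>, bound the loss
below by a simple function, replace each cell (source point, value of the simple function) by one
of its points with no more than the average cost, and restore the budget by leaving a small
fraction of the mass in place. Expected losses of plans are real-valued, continuous and convex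
on \<open>B\<close>, and plans can be mixed.

Both claims follow from one selection principle, \<open>saddle_point_selection\<close>. Let \<open>G\<close> be open and
suppose that off \<open>G\<close> the robust loss exceeds \<open>t\<close>. By compactness of the sublevel sets of the
coercive plan, the maximum of the losses of finitely many plans already exceeds \<open>t\<close> off \<open>G\<close>.
This maximum attains its minimum at some \<open>\<beta>\<close>, and by separation of convex sets a mixture \<open>r\<close> of
these plans has loss minimized at the same \<open>\<beta>\<close> with the same value. So \<open>\<beta>\<close> minimizes the loss of
a single plan, and either \<open>\<beta> \<in> G\<close> or its value exceeds \<open>t\<close>.

With \<open>G\<close> empty and \<open>t\<close> below the minimal robust loss, this is the minimax equality. For the
second claim let \<open>V\<close> be the infimum of the robust loss. If \<open>V\<close> is infinite, every point of \<open>B\<close> is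
robust optimal and \<open>G = UNIV\<close> gives a compatible one. If \<open>V\<close> is finite and no robust minimizer lay in
the closure of the compatible estimators, take the complement of this closure for \<open>G\<close> and \<open>t = V\<close>:
the point \<open>\<beta>\<close> is compatible, hence not in \<open>G\<close>, hence has value above \<open>V\<close>; but the minimal
expected loss of one distribution never exceeds \<open>V\<close>.\<close>

section \<open>Minimax for convex functions\<close>

text \<open>Separate the open quadrant below \<open>(t, t)\<close> from the set of points dominating some \<open>(f x, g x)\<close>. The
latter is closed upwards, so the normal vector has non-negative entries; normalized, they are the
weights.\<close>

lemma separation_two_convex:
  fixes f g :: "'b::real_vector \<Rightarrow> real"
  assumes f: "convex_on C f" and g: "convex_on C g"
    and ge: "\<And>x. x \<in> C \<Longrightarrow> t \<le> f x \<or> t \<le> g x"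
  obtains u where "0 \<le> u" "u \<le> 1" "\<And>x. x \<in> C \<Longrightarrow> t \<le> u * f x + (1 - u) * g x"
proof (cases "C = {}")
  case True
  then show ?thesis using that[of 0] by simp
next
  case False
  define L where "L = {p. fst p < t} \<inter> {p. snd p < (t::real)}"
  define H where "H = {p. \<exists>x\<in>C. f x \<le> fst p \<and> g x \<le> snd p}"
  have C: "convex C" using f by (simp add: convex_on_def)
  have "L = {p. inner (1, 0) p < t} \<inter> {p. inner (0, 1) p < t}"
    by (auto simp: L_def inner_prod_def)
  then have "convex L" by (simp add: convex_Int convex_halfspace_lt)
  moreover have "convex H"
  proof (rule convexI)
    fix p p' :: "real \<times> real" and a b :: real
    assume "p \<in> H" "p' \<in> H" and ab: "0 \<le> a" "0 \<le> b" "a + b = 1"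
    then obtain x y where x: "x \<in> C" "f x \<le> fst p" "g x \<le> snd p"
      and y: "y \<in> C" "f y \<le> fst p'" "g y \<le> snd p'"
      unfolding H_def by blast
    have m: "a *\<^sub>R x + b *\<^sub>R y \<in> C"
      using C x(1) y(1) ab by (rule convexD)
    have "f (a *\<^sub>R x + b *\<^sub>R y) \<le> a * f x + b * f y"
      using f x(1) y(1) ab by (simp add: convex_on_def)
    also have "\<dots> \<le> a * fst p + b * fst p'"
      using x y ab by (intro add_mono mult_left_mono)
    finally have 1: "f (a *\<^sub>R x + b *\<^sub>R y) \<le> fst (a *\<^sub>R p + b *\<^sub>R p')" by simp
    have "g (a *\<^sub>R x + b *\<^sub>R y) \<le> a * g x + b * g y"
      using g x(1) y(1) ab by (simp add: convex_on_def)
    also have "\<dots> \<le> a * snd p + b * snd p'"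
      using x y ab by (intro add_mono mult_left_mono)
    finally have 2: "g (a *\<^sub>R x + b *\<^sub>R y) \<le> snd (a *\<^sub>R p + b *\<^sub>R p')" by simp
    show "a *\<^sub>R p + b *\<^sub>R p' \<in> H"
      unfolding H_def using m 1 2 by blast
  qed
  moreover have "L \<noteq> {}"
  proof -
    have "(t - 1, t - 1) \<in> L" by (simp add: L_def)
    then show ?thesis by blast
  qed
  moreover have "H \<noteq> {}" using False unfolding H_def by (auto intro: order.refl)
  moreover have "L \<inter> H = {}"
    unfolding L_def H_def using ge by fastforce
  ultimately obtain a b where ab: "a \<noteq> 0" "\<And>p. p \<in> L \<Longrightarrow> inner a p \<le> b" "\<And>p. p \<in> H \<Longrightarrow> b \<le> inner a p"
    using separating_hyperplane_sets[of L H] by metis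
  obtain a1 a2 where a: "a = (a1, a2)" by fastforce
  obtain x0 where x0: "x0 \<in> C" using False by blast
  have H1: "b \<le> a1 * r + a2 * s" if "x \<in> C" "f x \<le> r" "g x \<le> s" for x r s
    using ab(3)[of "(r, s)"] that unfolding H_def a by auto
  have L1: "a1 * r + a2 * s \<le> b" if "r < t" "s < t" for r s
    using ab(2)[of "(r, s)"] that unfolding L_def a by auto
  have a1: "0 \<le> a1"
  proof (rule ccontr)
    assume "\<not> 0 \<le> a1"
    then have n: "a1 < 0" by simp
    define r where "r = max (f x0) ((b - a2 * g x0 - 1) / a1)"
    have "b \<le> a1 * r + a2 * g x0" by (rule H1[OF x0]) (simp_all add: r_def)
    moreover have "a1 * r \<le> b - a2 * g x0 - 1"
    proof -
      have "(b - a2 * g x0 - 1) / a1 \<le> r" by (simp add: r_def)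
      then show ?thesis using n by (simp add: neg_divide_le_eq mult.commute)
    qed
    ultimately show False by linarith
  qed
  have a2: "0 \<le> a2"
  proof (rule ccontr)
    assume "\<not> 0 \<le> a2"
    then have n: "a2 < 0" by simp
    define r where "r = max (g x0) ((b - a1 * f x0 - 1) / a2)"
    have "b \<le> a1 * f x0 + a2 * r" by (rule H1[OF x0]) (simp_all add: r_def)
    moreover have "a2 * r \<le> b - a1 * f x0 - 1"
    proof -
      have "(b - a1 * f x0 - 1) / a2 \<le> r" by (simp add: r_def)
      then show ?thesis using n by (simp add: neg_divide_le_eq mult.commute)
    qed
    ultimately show False by linarith
  qed
  have pos: "0 < a1 + a2" using a1 a2 ab(1) a by (auto simp: zero_prod_def)
  \<comment> \<open>The corner \<open>(t, t)\<close> of the open quadrant is reached in the limit.\<close>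
  have tb: "(a1 + a2) * t \<le> b"
  proof (rule field_le_epsilon)
    fix e :: real assume "0 < e"
    then have "a1 * (t - e / (a1 + a2)) + a2 * (t - e / (a1 + a2)) \<le> b"
      using pos by (intro L1) auto
    then have "(a1 + a2) * (t - e / (a1 + a2)) \<le> b" by (simp only: distrib_right)
    then show "(a1 + a2) * t \<le> b + e" using pos by (simp add: right_diff_distrib)
  qed
  show ?thesis
  proof (rule that[of "a1 / (a1 + a2)"])
    fix x assume "x \<in> C"
    then have "(a1 + a2) * t \<le> a1 * f x + a2 * g x"
      using tb H1[of x "f x" "g x"] by simp
    then have "t \<le> (a1 * f x + a2 * g x) / (a1 + a2)"
      using pos by (simp add: pos_le_divide_eq mult.commute)
    also have "\<dots> = a1 / (a1 + a2) * f x + a2 / (a1 + a2) * g x"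
      by (simp add: add_divide_distrib)
    also have "a2 / (a1 + a2) = 1 - a1 / (a1 + a2)"
      using pos by (simp add: field_simps)
    finally show "t \<le> a1 / (a1 + a2) * f x + (1 - a1 / (a1 + a2)) * g x" .
  qed (use a1 a2 pos in auto)
qed

text \<open>Kneser's induction. The functions \<open>\<phi> p\<close> are mixed two at a time: on the convex set where the new
function lies below \<open>t\<close>, the remaining ones already reach \<open>t\<close>, so the induction hypothesis supplies a
mixture that does, and it is combined with the new function by the two-function case. Varying \<open>C\<close>
in the induction keeps the threshold \<open>t\<close> exact. The second conjunct records that the result is a
mixture of members of \<open>T\<close>: it stays below their maximum on all of \<open>B\<close>.\<close>

lemma finite_max_attained_by_mixture:
  fixes \<phi> :: "'p \<Rightarrow> 'b::real_vector \<Rightarrow> real"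
  assumes "finite T" "T \<noteq> {}" "T \<subseteq> \<P>" "convex C" "C \<subseteq> B"
    and cvx: "\<And>p. p \<in> \<P> \<Longrightarrow> convex_on B (\<phi> p)"
    and mix: "\<And>p p' u. p \<in> \<P> \<Longrightarrow> p' \<in> \<P> \<Longrightarrow> 0 \<le> u \<Longrightarrow> u \<le> 1
      \<Longrightarrow> \<exists>r\<in>\<P>. \<forall>\<beta>\<in>B. \<phi> r \<beta> = u * \<phi> p \<beta> + (1 - u) * \<phi> p' \<beta>"
    and ge: "\<And>\<beta>. \<beta> \<in> C \<Longrightarrow> \<exists>p\<in>T. t \<le> \<phi> p \<beta>"
  shows "\<exists>r\<in>\<P>. (\<forall>\<beta>\<in>C. t \<le> \<phi> r \<beta>) \<and> (\<forall>\<beta>\<in>B. \<forall>s. (\<forall>p\<in>T. \<phi> p \<beta> \<le> s) \<longrightarrow> \<phi> r \<beta> \<le> s)"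
  using assms(1-5) ge
proof (induction T arbitrary: C rule: finite_ne_induct)
  case (singleton p)
  then show ?case by (intro bexI[of _ p]) auto
next
  case (insert p T)
  have p: "p \<in> \<P>" using insert.prems by simp
  define C' where "C' = {\<beta>\<in>C. \<phi> p \<beta> < t}"
  have cC: "convex_on C (\<phi> p)" if "p \<in> \<P>" for p
    using cvx[OF that] insert.prems convex_on_subset by blast
  have "convex C'"
  proof (rule convexI)
    fix x y :: 'b and a b :: real
    assume xy: "x \<in> C'" "y \<in> C'" and ab: "0 \<le> a" "0 \<le> b" "a + b = 1"
    have "\<phi> p (a *\<^sub>R x + b *\<^sub>R y) \<le> a * \<phi> p x + b * \<phi> p y"
      using cC[OF p] xy ab by (simp add: convex_on_def C'_def)
    also have "\<dots> < t"
      using xy ab by (intro convex_bound_lt) (auto simp: C'_def)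
    finally show "a *\<^sub>R x + b *\<^sub>R y \<in> C'"
      using xy convexD[OF insert.prems(2) _ _ ab] by (auto simp: C'_def)
  qed
  moreover have "\<exists>p\<in>T. t \<le> \<phi> p \<beta>" if "\<beta> \<in> C'" for \<beta>
    using that insert.prems(4)[of \<beta>] by (auto simp: C'_def)
  ultimately obtain r where r: "r \<in> \<P>" "\<forall>\<beta>\<in>C'. t \<le> \<phi> r \<beta>"
    "\<forall>\<beta>\<in>B. \<forall>s. (\<forall>p\<in>T. \<phi> p \<beta> \<le> s) \<longrightarrow> \<phi> r \<beta> \<le> s"
    using insert.IH[of C'] insert.prems by (auto simp: C'_def)
  have "t \<le> \<phi> r \<beta> \<or> t \<le> \<phi> p \<beta>" if "\<beta> \<in> C" for \<beta>
    using that r(2) by (force simp: C'_def)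
  then obtain u where u: "0 \<le> u" "u \<le> 1" "\<And>\<beta>. \<beta> \<in> C \<Longrightarrow> t \<le> u * \<phi> r \<beta> + (1 - u) * \<phi> p \<beta>"
    using separation_two_convex[OF cC[OF r(1)] cC[OF p], of t] by metis
  obtain r' where r': "r' \<in> \<P>" "\<forall>\<beta>\<in>B. \<phi> r' \<beta> = u * \<phi> r \<beta> + (1 - u) * \<phi> p \<beta>"
    using mix[OF r(1) p u(1,2)] by blast
  have "\<phi> r' \<beta> \<le> s" if "\<beta> \<in> B" "\<forall>p\<in>insert p T. \<phi> p \<beta> \<le> s" for \<beta> s
  proof -
    have "\<phi> r' \<beta> = u * \<phi> r \<beta> + (1 - u) * \<phi> p \<beta>" using r' that by blast
    also have "\<dots> \<le> s"
      using that r(3) u by (intro convex_bound_le) auto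
    finally show ?thesis .
  qed
  moreover have "\<forall>\<beta>\<in>C. t \<le> \<phi> r' \<beta>" using r'(2) u(3) insert.prems(3) by auto
  ultimately show ?case using r'(1) by blast
qed

lemma continuous_on_Max_image:
  fixes \<phi> :: "'p \<Rightarrow> 'b::topological_space \<Rightarrow> real"
  assumes "finite T" "T \<noteq> {}" "\<And>p. p \<in> T \<Longrightarrow> continuous_on S (\<phi> p)"
  shows "continuous_on S (\<lambda>x. MAX p\<in>T. \<phi> p x)"
  using assms by (induction T rule: finite_ne_induct) (auto intro!: continuous_on_max)

lemma compact_finite_strict_cover:
  fixes \<phi> :: "'p \<Rightarrow> 'b::topological_space \<Rightarrow> real"
  assumes "compact K" "\<And>p. p \<in> \<P> \<Longrightarrow> continuous_on K (\<phi> p)"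
    and "\<And>\<beta>. \<beta> \<in> K \<Longrightarrow> \<exists>p\<in>\<P>. (t p::real) < \<phi> p \<beta>"
  obtains T where "finite T" "T \<subseteq> \<P>" "\<And>\<beta>. \<beta> \<in> K \<Longrightarrow> \<exists>p\<in>T. t p < \<phi> p \<beta>"
proof -
  have "\<forall>p\<in>\<P>. \<exists>G. open G \<and> G \<inter> K = \<phi> p -` {t p<..} \<inter> K"
    using assms(2) open_greaterThan unfolding continuous_on_open_invariant by blast
  then obtain G where G: "\<forall>p\<in>\<P>. open (G p) \<and> G p \<inter> K = \<phi> p -` {t p<..} \<inter> K"
    by (rule bchoice[THEN exE])
  have in_G: "\<beta> \<in> G p \<longleftrightarrow> t p < \<phi> p \<beta>" if "p \<in> \<P>" "\<beta> \<in> K" for p \<beta>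
    using G that by (metis IntD1 IntI vimage_eq greaterThan_iff)
  have "K \<subseteq> (\<Union>p\<in>\<P>. G p)"
    using assms(3) in_G by blast
  then obtain T where T: "T \<subseteq> \<P>" "finite T" "K \<subseteq> (\<Union>p\<in>T. G p)"
    using compactE_image[OF assms(1), of \<P> G] G by metis
  show ?thesis
  proof (rule that[OF T(2,1)])
    fix \<beta> assume "\<beta> \<in> K"
    then obtain p where "p \<in> T" "\<beta> \<in> G p" using T(3) by blast
    then show "\<exists>p\<in>T. t p < \<phi> p \<beta>" using in_G \<open>\<beta> \<in> K\<close> T(1) by blast
  qed
qed

text \<open>The minimum of a finite maximum of convex functions is also the minimum, at the same point, of one
mixture of them. The coercive \<open>\<phi> p0\<close> provides compactness, and \<open>G\<close> marks where the minimizer is wanted;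
the alternative \<open>t < \<phi> r \<beta>\<close> is what minimax arguments refute or exploit.\<close>

lemma saddle_point_selection:
  fixes \<phi> :: "'p \<Rightarrow> 'b::euclidean_space \<Rightarrow> real"
  assumes B: "closed B" "convex B" "B \<noteq> {}"
    and cvx: "\<And>p. p \<in> \<P> \<Longrightarrow> convex_on B (\<phi> p)"
    and cont: "\<And>p. p \<in> \<P> \<Longrightarrow> continuous_on B (\<phi> p)"
    and mix: "\<And>p p' u. p \<in> \<P> \<Longrightarrow> p' \<in> \<P> \<Longrightarrow> 0 \<le> u \<Longrightarrow> u \<le> 1
      \<Longrightarrow> \<exists>r\<in>\<P>. \<forall>\<beta>\<in>B. \<phi> r \<beta> = u * \<phi> p \<beta> + (1 - u) * \<phi> p' \<beta>"
    and p0: "p0 \<in> \<P>" "\<And>s. bounded {\<beta>\<in>B. \<phi> p0 \<beta> \<le> s}"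
    and "open G" and out: "\<And>\<beta>. \<beta> \<in> B - G \<Longrightarrow> \<exists>p\<in>\<P>. t < \<phi> p \<beta>"
  obtains r \<beta> where "r \<in> \<P>" "\<beta> \<in> B" "\<And>b. b \<in> B \<Longrightarrow> \<phi> r \<beta> \<le> \<phi> r b" "\<beta> \<in> G \<or> t < \<phi> r \<beta>"
proof -
  have sub: "compact {\<beta>\<in>B. \<phi> p0 \<beta> \<le> s}" for s
    using p0 B(1) cont[OF p0(1)] continuous_on_closed_Collect_le[OF cont[OF p0(1)] continuous_on_const B(1)]
    by (simp add: compact_eq_bounded_closed)
  have "compact ({\<beta>\<in>B. \<phi> p0 \<beta> \<le> t} - G)"
    using sub \<open>open G\<close> by (rule compact_diff)
  then obtain T0 where T0: "finite T0" "T0 \<subseteq> \<P>"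
    "\<And>\<beta>. \<beta> \<in> {\<beta>\<in>B. \<phi> p0 \<beta> \<le> t} - G \<Longrightarrow> \<exists>p\<in>T0. t < \<phi> p \<beta>"
  proof (rule compact_finite_strict_cover[where \<phi> = \<phi> and t = "\<lambda>_. t"])
    show "continuous_on ({\<beta> \<in> B. \<phi> p0 \<beta> \<le> t} - G) (\<phi> p)" if "p \<in> \<P>" for p
      using cont[OF that] by (rule continuous_on_subset) auto
  qed (use out in auto)
  \<comment> \<open>Including \<open>p0\<close> makes the maximum coercive and larger than \<open>t\<close> off the compact set too.\<close>
  define T where "T = insert p0 T0"
  have T: "finite T" "T \<noteq> {}" "T \<subseteq> \<P>" using T0 p0 by (auto simp: T_def)
  have outT: "\<exists>p\<in>T. t < \<phi> p \<beta>" if "\<beta> \<in> B - G" for \<beta>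
    using T0(3)[of \<beta>] that by (cases "\<phi> p0 \<beta> \<le> t") (auto simp: T_def)
  define m where "m \<beta> = (MAX p\<in>T. \<phi> p \<beta>)" for \<beta>
  have mcont: "continuous_on B m"
    unfolding m_def using T cont by (intro continuous_on_Max_image) auto
  have m_ge: "\<phi> p \<beta> \<le> m \<beta>" if "p \<in> T" for p \<beta>
    unfolding m_def using T that by (intro Max_ge) auto
  obtain b0 where b0: "b0 \<in> B" using B by blast
  define K where "K = {\<beta>\<in>B. \<phi> p0 \<beta> \<le> m b0}"
  have "b0 \<in> K" using b0 m_ge by (auto simp: K_def T_def)
  moreover have "continuous_on K m" using mcont by (rule continuous_on_subset) (auto simp: K_def)
  ultimately obtain \<beta> where \<beta>: "\<beta> \<in> K" "\<And>b. b \<in> K \<Longrightarrow> m \<beta> \<le> m b"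
    using continuous_attains_inf[of K m] sub unfolding K_def by blast
  have \<beta>B: "\<beta> \<in> B" using \<beta> by (simp add: K_def)
  have \<beta>min: "m \<beta> \<le> m b" if "b \<in> B" for b
  proof (cases "b \<in> K")
    case False
    then have "m b0 < \<phi> p0 b" using that by (simp add: K_def)
    also have "\<dots> \<le> m b" by (rule m_ge) (simp add: T_def)
    finally show ?thesis using \<beta>(2)[OF \<open>b0 \<in> K\<close>] by simp
  qed (use \<beta> in blast)
  have "\<exists>p\<in>T. m \<beta> \<le> \<phi> p b" if "b \<in> B" for b
  proof -
    have "m b \<in> (\<lambda>p. \<phi> p b) ` T" unfolding m_def using T by (intro Max_in) auto
    then show ?thesis using \<beta>min[OF that] by auto
  qed
  with finite_max_attained_by_mixture[OF T B(2) order.refl cvx mix]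
  have "\<exists>r\<in>\<P>. (\<forall>b\<in>B. m \<beta> \<le> \<phi> r b) \<and> (\<forall>b\<in>B. \<forall>s. (\<forall>p\<in>T. \<phi> p b \<le> s) \<longrightarrow> \<phi> r b \<le> s)"
    by blast
  then obtain r where r: "r \<in> \<P>" "\<And>b. b \<in> B \<Longrightarrow> m \<beta> \<le> \<phi> r b"
    "\<And>b s. b \<in> B \<Longrightarrow> (\<And>p. p \<in> T \<Longrightarrow> \<phi> p b \<le> s) \<Longrightarrow> \<phi> r b \<le> s"
    by blast
  have eq: "\<phi> r \<beta> = m \<beta>" using r(2,3)[OF \<beta>B] m_ge by (intro antisym) auto
  have "\<beta> \<in> G \<or> t < \<phi> r \<beta>"
  proof (rule disjCI)
    assume "\<not> t < \<phi> r \<beta>"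
    then have "\<not> t < \<phi> p \<beta>" if "p \<in> T" for p
      using m_ge[OF that, of \<beta>] eq by simp
    then show "\<beta> \<in> G" using outT[of \<beta>] \<beta>B by blast
  qed
  then show ?thesis using that[OF r(1) \<beta>B] r(2) eq by simp
qed

text \<open>On the unit sphere about \<open>\<beta>0\<close>, compactness yields finitely many \<open>x\<close> and a common gain \<open>\<eta> > 0\<close> of
\<open>f x\<close> over its value at \<open>\<beta>0\<close>. Convexity forces the gain at distance \<open>t \<ge> 1\<close> to be at least
\<open>\<eta> * t\<close>.\<close>

lemma finite_coercive_subfamily:
  fixes f :: "'p \<Rightarrow> 'b::euclidean_space \<Rightarrow> real"
  assumes B: "closed B" "\<beta>0 \<in> B"
    and cvx: "\<And>x. x \<in> A \<Longrightarrow> convex_on B (f x)"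
    and cont: "\<And>x. x \<in> A \<Longrightarrow> continuous_on B (f x)"
    and nn: "\<And>x \<beta>. x \<in> A \<Longrightarrow> \<beta> \<in> B \<Longrightarrow> 0 \<le> f x \<beta>"
    and grow: "\<And>\<beta>. \<beta> \<in> B \<Longrightarrow> \<beta> \<noteq> \<beta>0 \<Longrightarrow> \<exists>x\<in>A. f x \<beta>0 < f x \<beta>"
    and "A \<noteq> {}"
  obtains J where "finite J" "J \<noteq> {}" "J \<subseteq> A" "\<And>s. bounded {\<beta>\<in>B. \<forall>x\<in>J. f x \<beta> \<le> s}"
proof -
  have cB: "convex B" using \<open>A \<noteq> {}\<close> cvx by (auto simp: convex_on_def)
  define S where "S = sphere \<beta>0 1 \<inter> B"
  have "compact S" unfolding S_def using B(1) by (intro compact_Int_closed) auto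
  have contS: "continuous_on S (f x)" if "x \<in> A" for x
    using cont[OF that] by (rule continuous_on_subset) (auto simp: S_def)
  have growS: "\<exists>x\<in>A. f x \<beta>0 < f x \<beta>" if "\<beta> \<in> S" for \<beta>
    using that by (intro grow) (auto simp: S_def)
  obtain J0 where J0: "finite J0" "J0 \<subseteq> A" "\<And>\<beta>. \<beta> \<in> S \<Longrightarrow> \<exists>x\<in>J0. f x \<beta>0 < f x \<beta>"
    using compact_finite_strict_cover[of S A f "\<lambda>x. f x \<beta>0"] \<open>compact S\<close> contS growS by blast
  obtain a where "a \<in> A" using \<open>A \<noteq> {}\<close> by blast
  \<comment> \<open>\<open>J0\<close> is possibly empty, when \<open>B\<close> does not meet the sphere.\<close>
  define J where "J = insert a J0"
  have J: "finite J" "J \<noteq> {}" "J \<subseteq> A" using J0 \<open>a \<in> A\<close> by (auto simp: J_def)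
  define m where "m \<beta> = (MAX x\<in>J. f x \<beta> - f x \<beta>0)" for \<beta>
  have m_in: "\<exists>x\<in>J. m \<beta> = f x \<beta> - f x \<beta>0" for \<beta>
  proof -
    have "m \<beta> \<in> (\<lambda>x. f x \<beta> - f x \<beta>0) ` J" unfolding m_def using J by (intro Max_in) auto
    then show ?thesis by auto
  qed
  have m_pos: "0 < m \<beta>" if \<beta>: "\<beta> \<in> S" for \<beta>
  proof -
    obtain x where "x \<in> J" "0 < f x \<beta> - f x \<beta>0" using J0(3)[OF \<beta>] by (auto simp: J_def)
    then show ?thesis unfolding m_def using J by (subst Max_gr_iff) auto
  qed
  obtain \<eta> where \<eta>: "0 < \<eta>" "\<And>\<beta>. \<beta> \<in> S \<Longrightarrow> \<eta> \<le> m \<beta>"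
  proof (cases "S = {}")
    case False
    have "continuous_on S m"
      unfolding m_def using J contS by (intro continuous_on_Max_image continuous_intros) auto
    then show ?thesis
      using continuous_attains_inf[OF \<open>compact S\<close> False, of m] m_pos that by metis
  qed (use that[of 1] in auto)
  have "bounded {\<beta>\<in>B. \<forall>x\<in>J. f x \<beta> \<le> s}" for s
  proof (rule bounded_subset[OF bounded_cball])
    show "{\<beta>\<in>B. \<forall>x\<in>J. f x \<beta> \<le> s} \<subseteq> cball \<beta>0 (max 1 (s / \<eta>))"
    proof safe
      fix \<beta> assume \<beta>: "\<beta> \<in> B" "\<forall>x\<in>J. f x \<beta> \<le> s"
      define t where "t = dist \<beta>0 \<beta>"
      show "\<beta> \<in> cball \<beta>0 (max 1 (s / \<eta>))"
      proof (cases "t \<le> 1")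
        case False
        then have t: "t > 1" by simp
        \<comment> \<open>the point where the segment from \<open>\<beta>0\<close> to \<open>\<beta>\<close> crosses the unit sphere\<close>
        define b where "b = (1 - 1 / t) *\<^sub>R \<beta>0 + (1 / t) *\<^sub>R \<beta>"
        have "b \<in> B" unfolding b_def using t \<beta> B cB by (intro convexD) auto
        moreover have "b - \<beta>0 = (1 / t) *\<^sub>R (\<beta> - \<beta>0)" by (simp add: b_def algebra_simps)
        then have "dist \<beta>0 b = 1"
          using t by (metis t_def dist_norm dist_commute norm_scaleR abs_of_pos zero_less_divide_1_iff
              less_trans zero_less_one nonzero_divide_eq_eq less_irrefl)
        ultimately have "b \<in> S" by (simp add: S_def)
        obtain x where x: "x \<in> J" "m b = f x b - f x \<beta>0" using m_in by blast
        have xA: "x \<in> A" using x J by blast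
        have "f x b \<le> (1 - 1 / t) * f x \<beta>0 + (1 / t) * f x \<beta>"
          unfolding b_def using t \<beta> B by (intro convex_onD[OF cvx[OF xA]]) auto
        then have "\<eta> \<le> (1 / t) * (f x \<beta> - f x \<beta>0)"
          using \<eta>(2)[OF \<open>b \<in> S\<close>] x by (simp add: algebra_simps)
        then have "\<eta> * t \<le> f x \<beta> - f x \<beta>0" using t by (simp add: field_simps)
        also have "\<dots> \<le> s" using \<beta> x nn[OF xA B(2)] by fastforce
        finally have "t \<le> s / \<eta>" using \<eta>(1) by (simp add: field_simps)
        then show ?thesis by (simp add: t_def)
      qed (simp add: t_def)
    qed
  qed
  then show ?thesis using that J by blast
qed

section \<open>Finitely supported measures\<close>

text \<open>A \<open>pmf\<close> is a measure on the full power set of its type. Here it is transported to the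
\<open>\<sigma>\<close>-algebra and carrier of \<open>N\<close>; the default value makes the map total when
\<open>space N\<close> is not the whole type.\<close>

definition realize :: "'a measure \<Rightarrow> 'a pmf \<Rightarrow> 'a measure" where
  "realize N p = distr (measure_pmf p) N (\<lambda>z. if z \<in> space N then z else SOME z. z \<in> space N)"

lemma sets_realize [simp]: "sets (realize N p) = sets N"
  and space_realize [simp]: "space (realize N p) = space N"
  by (simp_all add: realize_def)

context
  fixes p :: "'a pmf" and N :: "'a measure"
  assumes supp: "set_pmf p \<subseteq> space N"
begin

lemma realize_measurable:
  "(\<lambda>z. if z \<in> space N then z else SOME z. z \<in> space N) \<in> measure_pmf p \<rightarrow>\<^sub>M N"
proof -
  have "space N \<noteq> {}" using supp set_pmf_not_empty[of p] by blast
  then have "(SOME z. z \<in> space N) \<in> space N" by (simp add: some_in_eq)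
  then show ?thesis by simp
qed

lemma prob_space_realize: "prob_space (realize N p)"
  unfolding realize_def by (rule measure_pmf.prob_space_distr[OF realize_measurable])

lemma nn_integral_realize:
  "f \<in> borel_measurable N \<Longrightarrow> (\<integral>\<^sup>+ z. f z \<partial>realize N p) = (\<integral>\<^sup>+ z. f z \<partial>measure_pmf p)"
  unfolding realize_def using supp
  by (subst nn_integral_distr[OF realize_measurable])
     (auto intro!: nn_integral_cong_AE simp: AE_measure_pmf_iff)

lemma emeasure_realize: "A \<in> sets N \<Longrightarrow> emeasure (realize N p) A = emeasure (measure_pmf p) A"
  using nn_integral_realize[of "indicator A"] by simp

lemma AE_realize: "X \<in> sets N \<Longrightarrow> set_pmf p \<subseteq> X \<Longrightarrow> AE z in realize N p. z \<in> X"
  unfolding realize_def using supp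
  by (subst AE_distr_iff[OF realize_measurable]) (auto simp: AE_measure_pmf_iff)

end

lemma distr_realize_map_pmf:
  assumes supp: "set_pmf p \<subseteq> space N" and h: "h \<in> N \<rightarrow>\<^sub>M N'"
  shows "distr (realize N p) N' h = realize N' (map_pmf h p)"
proof (rule measure_eqI)
  have supp': "set_pmf (map_pmf h p) \<subseteq> space N'"
    using supp measurable_space[OF h] by auto
  fix A assume "A \<in> sets (distr (realize N p) N' h)"
  then have A: "A \<in> sets N'" by simp
  have hN: "h \<in> realize N p \<rightarrow>\<^sub>M N'" using h by (simp add: measurable_cong_sets[OF sets_realize refl])
  have "emeasure (distr (realize N p) N' h) A = emeasure (measure_pmf p) (h -` A \<inter> space N)"
    using emeasure_realize[OF supp measurable_sets[OF h A]] A by (simp add: emeasure_distr[OF hN])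
  also have "\<dots> = emeasure (measure_pmf p) (h -` A)"
    using supp by (intro emeasure_eq_AE) (auto simp: AE_measure_pmf_iff)
  also have "\<dots> = emeasure (realize N' (map_pmf h p)) A"
    using A by (simp add: emeasure_realize[OF supp'])
  finally show "emeasure (distr (realize N p) N' h) A = emeasure (realize N' (map_pmf h p)) A" .
qed simp

lemma point_below_average:
  assumes h: "h \<in> borel_measurable M" and C: "C \<in> sets M" "C \<noteq> {}" and fin: "emeasure M C \<noteq> \<infinity>"
  shows "\<exists>z\<in>C. h z * emeasure M C \<le> (\<integral>\<^sup>+ z. h z * indicator C z \<partial>M)"
proof (rule ccontr)
  define I where "I = (\<integral>\<^sup>+ z. h z * indicator C z \<partial>M)"
  define e where "e = emeasure M C"
  assume "\<not> ?thesis"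
  then have less: "I < h z * e" if "z \<in> C" for z
    using that by (auto simp: I_def e_def not_le)
  have e0: "e \<noteq> 0" using less C(2) by fastforce
  have Ifin: "I \<noteq> \<infinity>" using less C(2) by fastforce
  have eI: "I / e * e = I"
    using e0 fin by (simp add: e_def ennreal_divide_times ennreal_times_divide mult.commute mult_divide_eq_ennreal)
  have lt: "I / e < h z" if "z \<in> C" for z
  proof (rule ccontr)
    assume "\<not> I / e < h z"
    then have "h z * e \<le> I / e * e" by (intro mult_right_mono) auto
    then show False using less[OF that] eI by simp
  qed
  have int: "(\<integral>\<^sup>+ z. I / e * indicator C z \<partial>M) = I"
    using C eI by (simp add: nn_integral_cmult_indicator e_def)
  have "(\<integral>\<^sup>+ z. I / e * indicator C z \<partial>M) < (\<integral>\<^sup>+ z. h z * indicator C z \<partial>M)"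
  proof (rule nn_integral_less)
    show "AE z in M. I / e * indicator C z \<le> h z * indicator C z"
      using lt by (intro AE_I2) (auto split: split_indicator intro: less_imp_le)
    show "\<not> (AE z in M. h z * indicator C z \<le> I / e * indicator C z)"
    proof
      assume "AE z in M. h z * indicator C z \<le> I / e * indicator C z"
      then have "AE z in M. z \<notin> C"
        by eventually_elim (use lt in \<open>auto split: split_indicator_asm simp: not_less[symmetric]\<close>)
      then have "C \<in> null_sets M" using C(1) by (simp add: AE_iff_null_sets)
      then show False using e0 by (auto simp: e_def dest: null_setsD1)
    qed
  qed (use h C int Ifin in auto)
  then show False using int by (simp add: I_def)
qed

text \<open>Discretization without approximation error: collapse each cell on which \<open>\<kappa>\<close> is constant to one
point where \<open>h\<close> does not exceed its average over the cell. The law of \<open>\<kappa>\<close> is preserved exactly and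
the mean of \<open>h\<close> does not increase.\<close>

lemma finite_pmf_with_simple_law:
  fixes \<kappa> :: "'z \<Rightarrow> 'k" and h :: "'z \<Rightarrow> ennreal"
  assumes "prob_space \<pi>" and \<kappa>: "simple_function \<pi> \<kappa>" and h: "h \<in> borel_measurable \<pi>"
  obtains p where "finite (set_pmf p)" "set_pmf p \<subseteq> space \<pi>"
    "measure_pmf (map_pmf \<kappa> p) = distr \<pi> (count_space UNIV) \<kappa>"
    "(\<integral>\<^sup>+ z. h z \<partial>measure_pmf p) \<le> (\<integral>\<^sup>+ z. h z \<partial>\<pi>)"
proof -
  interpret prob_space \<pi> by fact
  define K where "K = \<kappa> ` space \<pi>"
  define C where "C k = \<kappa> -` {k} \<inter> space \<pi>" for k
  have K: "finite K" using \<kappa> by (simp add: K_def simple_function_def)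
  have \<kappa>m: "\<kappa> \<in> \<pi> \<rightarrow>\<^sub>M count_space UNIV" using \<kappa> by (rule measurable_simple_function)
  have C: "C k \<in> sets \<pi>" for k unfolding C_def by (rule measurable_sets[OF \<kappa>m]) simp
  have "\<forall>k\<in>K. \<exists>z. z \<in> C k \<and> h z * emeasure \<pi> (C k) \<le> (\<integral>\<^sup>+ z. h z * indicator (C k) z \<partial>\<pi>)"
  proof
    fix k assume "k \<in> K"
    then have "C k \<noteq> {}" by (auto simp: K_def C_def)
    from point_below_average[OF h C this]
    show "\<exists>z. z \<in> C k \<and> h z * emeasure \<pi> (C k) \<le> (\<integral>\<^sup>+ z. h z * indicator (C k) z \<partial>\<pi>)"
      by auto
  qed
  then obtain rep where rep: "\<And>k. k \<in> K \<Longrightarrow> rep k \<in> C k"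
    "\<And>k. k \<in> K \<Longrightarrow> h (rep k) * emeasure \<pi> (C k) \<le> (\<integral>\<^sup>+ z. h z * indicator (C k) z \<partial>\<pi>)"
    by metis
  define D where "D = distr \<pi> (count_space UNIV) \<kappa>"
  interpret D: prob_space D unfolding D_def by (rule prob_space_distr[OF \<kappa>m])
  have "AE k in D. k \<in> K"
    unfolding D_def by (subst AE_distr_iff[OF \<kappa>m]) (auto simp: K_def)
  then have "AE k in D. measure D {k} \<noteq> 0"
    using D.AE_support_countable countable_finite[OF K] by (auto simp: D_def)
  then have D: "measure_pmf (Abs_pmf D) = D"
    using D.prob_space_axioms by (intro Abs_pmf_inverse CollectI conjI) (simp_all add: D_def)
  have pmf_D: "ennreal (pmf (Abs_pmf D) k) = emeasure \<pi> (C k)" for k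
    unfolding emeasure_pmf_single[symmetric] D
    by (simp add: D_def emeasure_distr[OF \<kappa>m] C_def)
  have supp: "set_pmf (Abs_pmf D) \<subseteq> K"
  proof
    fix k assume "k \<in> set_pmf (Abs_pmf D)"
    then have "pmf (Abs_pmf D) k > 0" by (rule pmf_positive)
    then have "C k \<noteq> {}" using pmf_D[of k] by fastforce
    then show "k \<in> K" by (auto simp: K_def C_def)
  qed
  \<comment> \<open>the law of \<open>\<kappa>\<close>, carried by the representatives\<close>
  define p where "p = map_pmf rep (Abs_pmf D)"
  have "map_pmf \<kappa> p = map_pmf (\<lambda>k. k) (Abs_pmf D)"
    unfolding p_def map_pmf_comp using rep(1) supp by (intro map_pmf_cong) (auto simp: C_def)
  then have law: "measure_pmf (map_pmf \<kappa> p) = D" by (simp add: D)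
  have "(\<integral>\<^sup>+ z. h z \<partial>measure_pmf p) = (\<integral>\<^sup>+ k. h (rep k) \<partial>measure_pmf (Abs_pmf D))"
    by (simp add: p_def)
  also have "\<dots> = (\<Sum>k\<in>K. h (rep k) * pmf (Abs_pmf D) k)"
    using K supp by (intro nn_integral_measure_pmf_support) auto
  also have "\<dots> \<le> (\<Sum>k\<in>K. \<integral>\<^sup>+ z. h z * indicator (C k) z \<partial>\<pi>)"
    unfolding pmf_D by (intro sum_mono rep)
  also have "\<dots> = (\<integral>\<^sup>+ z. (\<Sum>k\<in>K. h z * indicator (C k) z) \<partial>\<pi>)"
    using h C by (intro nn_integral_sum[symmetric]) auto
  also have "\<dots> \<le> (\<integral>\<^sup>+ z. h z \<partial>\<pi>)"
  proof (rule nn_integral_mono)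
    fix z assume z: "z \<in> space \<pi>"
    have "(\<Sum>k\<in>K. h z * indicator (C k) z) = (\<Sum>k\<in>K. if k = \<kappa> z then h z else 0)"
      using z by (intro sum.cong) (auto simp: C_def indicator_def)
    also have "\<dots> \<le> h z" using K by (simp add: sum.delta)
    finally show "(\<Sum>k\<in>K. h z * indicator (C k) z) \<le> h z" .
  qed
  finally have "(\<integral>\<^sup>+ z. h z \<partial>measure_pmf p) \<le> (\<integral>\<^sup>+ z. h z \<partial>\<pi>)" .
  moreover have "finite (set_pmf p)" "set_pmf p \<subseteq> space \<pi>"
    using finite_subset[OF supp K] supp rep(1) by (auto simp: p_def C_def)
  ultimately show ?thesis using that law by (auto simp: D_def)
qed

lemma space_borel_on [simp]: "space (borel_on \<Omega>) = \<Omega>"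
  by (simp add: space_restrict_space)

lemma nn_integral_finite_pmf:
  assumes "finite (set_pmf p)" "\<And>z. z \<in> set_pmf p \<Longrightarrow> 0 \<le> f z"
  shows "(\<integral>\<^sup>+ z. ennreal (f z) \<partial>measure_pmf p) = ennreal (measure_pmf.expectation p f)"
  using assms by (intro nn_integral_eq_integral integrable_measure_pmf_finite) (auto simp: AE_measure_pmf_iff)

lemma expectation_pmf_nonneg:
  "(\<And>z. z \<in> set_pmf p \<Longrightarrow> 0 \<le> (f z :: real)) \<Longrightarrow> 0 \<le> measure_pmf.expectation p f"
  by (intro integral_nonneg_AE) (auto simp: AE_measure_pmf_iff)

definition mix_pmf :: "real \<Rightarrow> 'z pmf \<Rightarrow> 'z pmf \<Rightarrow> 'z pmf" where
  "mix_pmf u p p' = bind_pmf (bernoulli_pmf u) (\<lambda>b. if b then p else p')"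

lemma set_mix_pmf: "set_pmf (mix_pmf u p p') \<subseteq> set_pmf p \<union> set_pmf p'"
  by (auto simp: mix_pmf_def split: if_splits)

lemma finite_set_mix_pmf:
  "finite (set_pmf p) \<Longrightarrow> finite (set_pmf p') \<Longrightarrow> finite (set_pmf (mix_pmf u p p'))"
  by (rule finite_subset[OF set_mix_pmf]) simp

lemma map_mix_pmf: "map_pmf f (mix_pmf u p p') = mix_pmf u (map_pmf f p) (map_pmf f p')"
  by (simp add: mix_pmf_def map_bind_pmf if_distrib)

lemma mix_pmf_same [simp]: "mix_pmf u p p = p"
  by (simp add: mix_pmf_def)

lemma expectation_mix_pmf:
  fixes f :: "'z \<Rightarrow> real"
  assumes "0 \<le> u" "u \<le> 1" "finite (set_pmf p)" "finite (set_pmf p')"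
  shows "measure_pmf.expectation (mix_pmf u p p') f
    = u * measure_pmf.expectation p f + (1 - u) * measure_pmf.expectation p' f"
  unfolding mix_pmf_def using assms
  by (subst pmf_expectation_bind[of UNIV]) (auto simp: UNIV_bool)

section \<open>Finitely supported transport plans\<close>

definition finite_plans ::
  "('a \<Rightarrow> 'a \<Rightarrow> real) \<Rightarrow> 'a set \<Rightarrow> real \<Rightarrow> 'a pmf \<Rightarrow> ('a \<times> 'a) pmf set" where
  "finite_plans c \<Omega> \<delta> q = {p. finite (set_pmf p) \<and> set_pmf p \<subseteq> \<Omega> \<times> \<Omega> \<and> map_pmf fst p = q
     \<and> measure_pmf.expectation p (\<lambda>z. c (fst z) (snd z)) \<le> \<delta>}"

definition plan_loss :: "('a \<Rightarrow> 'b \<Rightarrow> real) \<Rightarrow> ('a \<times> 'a) pmf \<Rightarrow> 'b \<Rightarrow> real" where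
  "plan_loss l p \<beta> = measure_pmf.expectation p (\<lambda>z. l (snd z) \<beta>)"

lemma plan_loss_eq_sum:
  "finite (set_pmf p) \<Longrightarrow> plan_loss l p = (\<lambda>\<beta>. \<Sum>z\<in>set_pmf p. l (snd z) \<beta> * pmf p z)"
  unfolding plan_loss_def by (intro ext integral_measure_pmf_real) auto

lemma plan_loss_nonneg:
  assumes "p \<in> finite_plans c \<Omega> \<delta> q" "\<And>x. x \<in> \<Omega> \<Longrightarrow> 0 \<le> l x \<beta>"
  shows "0 \<le> plan_loss l p \<beta>"
  unfolding plan_loss_def using assms by (intro expectation_pmf_nonneg) (auto simp: finite_plans_def)

lemma continuous_on_plan_loss:
  assumes "p \<in> finite_plans c \<Omega> \<delta> q" "\<And>x. x \<in> \<Omega> \<Longrightarrow> continuous_on B (l x)"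
  shows "continuous_on B (plan_loss l p)"
  using assms by (auto simp: finite_plans_def plan_loss_eq_sum intro!: continuous_intros)

lemma convex_on_plan_loss:
  assumes p: "p \<in> finite_plans c \<Omega> \<delta> q" and cvx: "\<And>x. x \<in> \<Omega> \<Longrightarrow> convex_on B (l x)"
  shows "convex_on B (plan_loss l p)"
proof -
  have fin: "finite (set_pmf p)" and sub: "\<And>z. z \<in> set_pmf p \<Longrightarrow> snd z \<in> \<Omega>"
    using p by (auto simp: finite_plans_def)
  have "convex B" using set_pmf_not_empty[of p] sub cvx by (auto simp: convex_on_def)
  moreover have "plan_loss l p (a *\<^sub>R x + b *\<^sub>R y) \<le> a * plan_loss l p x + b * plan_loss l p y"
    if "x \<in> B" "y \<in> B" and ab: "0 \<le> a" "0 \<le> b" "a + b = 1" for x y a b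
  proof -
    have "l (snd z) (a *\<^sub>R x + b *\<^sub>R y) * pmf p z
        \<le> a * (l (snd z) x * pmf p z) + b * (l (snd z) y * pmf p z)" if "z \<in> set_pmf p" for z
    proof -
      have "l (snd z) (a *\<^sub>R x + b *\<^sub>R y) \<le> a * l (snd z) x + b * l (snd z) y"
        using cvx[OF sub[OF that]] \<open>x \<in> B\<close> \<open>y \<in> B\<close> ab by (simp add: convex_on_def)
      from mult_right_mono[OF this pmf_nonneg] show ?thesis by (simp add: algebra_simps)
    qed
    then show ?thesis
      unfolding plan_loss_eq_sum[OF fin] sum_distrib_left sum.distrib[symmetric] by (intro sum_mono)
  qed
  ultimately show ?thesis by (simp add: convex_on_def)
qed

lemma mix_finite_plans:
  assumes u: "0 \<le> u" "u \<le> 1" and p: "p \<in> finite_plans c \<Omega> \<delta>1 q" and p': "p' \<in> finite_plans c \<Omega> \<delta>2 q"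
  shows "mix_pmf u p p' \<in> finite_plans c \<Omega> (u * \<delta>1 + (1 - u) * \<delta>2) q"
    and "plan_loss l (mix_pmf u p p') \<beta> = u * plan_loss l p \<beta> + (1 - u) * plan_loss l p' \<beta>"
proof -
  have fin: "finite (set_pmf p)" "finite (set_pmf p')"
    using p p' by (auto simp: finite_plans_def)
  have "u * measure_pmf.expectation p (\<lambda>z. c (fst z) (snd z))
      + (1 - u) * measure_pmf.expectation p' (\<lambda>z. c (fst z) (snd z)) \<le> u * \<delta>1 + (1 - u) * \<delta>2"
    using u p p' by (intro add_mono mult_left_mono) (auto simp: finite_plans_def)
  then show "mix_pmf u p p' \<in> finite_plans c \<Omega> (u * \<delta>1 + (1 - u) * \<delta>2) q"
    using p p' set_mix_pmf[of u p p'] finite_set_mix_pmf[OF fin]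
    by (auto simp: finite_plans_def map_mix_pmf expectation_mix_pmf[OF u fin])
  show "plan_loss l (mix_pmf u p p') \<beta> = u * plan_loss l p \<beta> + (1 - u) * plan_loss l p' \<beta>"
    unfolding plan_loss_def by (rule expectation_mix_pmf[OF u fin])
qed

lemma diagonal_finite_plan:
  assumes "finite (set_pmf q)" "set_pmf q \<subseteq> \<Omega>" "\<And>x. c x x = 0"
  shows "map_pmf (\<lambda>x. (x, x)) q \<in> finite_plans c \<Omega> 0 q"
  using assms by (auto simp: finite_plans_def map_pmf_comp)

section \<open>Plans and the uncertainty set\<close>

lemma wasserstein_le_sqrt_iff:
  assumes "0 \<le> \<delta>"
  shows "wasserstein c \<Omega> P Q \<le> ennreal (sqrt \<delta>) \<longleftrightarrow> transport_cost c \<Omega> P Q \<le> ennreal \<delta>"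
  using assms
  by (cases "transport_cost c \<Omega> P Q") (auto simp: wasserstein_def sqrt_ennreal_def top_unique)

lemma finite_plan_realizes_uncertain_dist:
  fixes \<Omega> :: "'a::topological_space set"
  assumes p: "p \<in> finite_plans c \<Omega> \<delta> q" and "0 \<le> \<delta>"
    and c: "\<And>x y. 0 \<le> c x y"
      "(\<lambda>z. c (fst z) (snd z)) \<in> borel_measurable (borel_on \<Omega> \<Otimes>\<^sub>M borel_on \<Omega>)"
    and l: "\<And>\<beta>. \<beta> \<in> B \<Longrightarrow> (\<lambda>x. l x \<beta>) \<in> borel_measurable (borel_on \<Omega>)"
      "\<And>x \<beta>. x \<in> \<Omega> \<Longrightarrow> \<beta> \<in> B \<Longrightarrow> 0 \<le> l x \<beta>"
  shows "\<exists>P\<in>uncertainty c \<Omega> \<delta> (realize (borel_on \<Omega>) q).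
    \<forall>\<beta>\<in>B. expected_loss l P \<beta> = ennreal (plan_loss l p \<beta>)"
proof -
  let ?N = "borel_on \<Omega>"
  let ?NN = "borel_on \<Omega> \<Otimes>\<^sub>M borel_on \<Omega>"
  have fin: "finite (set_pmf p)" and supp: "set_pmf p \<subseteq> space ?NN"
    and q: "map_pmf fst p = q" and cost: "measure_pmf.expectation p (\<lambda>z. c (fst z) (snd z)) \<le> \<delta>"
    using p by (auto simp: finite_plans_def space_pair_measure)
  define P where "P = realize ?N (map_pmf snd p)"
  have supp': "set_pmf (map_pmf snd p) \<subseteq> space ?N"
    using supp by (auto simp: space_pair_measure)
  have "realize ?NN p \<in> couplings \<Omega> (realize ?N q) P"
    unfolding couplings_def P_def q[symmetric]
    using prob_space_realize[OF supp] distr_realize_map_pmf[OF supp] by auto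
  then have "transport_cost c \<Omega> (realize ?N q) P
      \<le> (\<integral>\<^sup>+ z. ennreal (c (fst z) (snd z)) \<partial>realize ?NN p)"
    unfolding transport_cost_def by (rule INF_lower)
  also have "\<dots> = (\<integral>\<^sup>+ z. ennreal (c (fst z) (snd z)) \<partial>measure_pmf p)"
    using c(2) by (intro nn_integral_realize[OF supp]) auto
  also have "\<dots> = ennreal (measure_pmf.expectation p (\<lambda>z. c (fst z) (snd z)))"
    using c(1) by (intro nn_integral_finite_pmf fin)
  also have "\<dots> \<le> ennreal \<delta>" using cost by (rule ennreal_leI)
  finally have "P \<in> uncertainty c \<Omega> \<delta> (realize ?N q)"
    using prob_space_realize[OF supp'] wasserstein_le_sqrt_iff[OF \<open>0 \<le> \<delta>\<close>]
    by (auto simp: uncertainty_def prob_dists_def P_def)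
  moreover have "expected_loss l P \<beta> = ennreal (plan_loss l p \<beta>)" if "\<beta> \<in> B" for \<beta>
  proof -
    have "expected_loss l P \<beta> = (\<integral>\<^sup>+ z. ennreal (l (snd z) \<beta>) \<partial>measure_pmf p)"
      unfolding expected_loss_def P_def
      using l(1)[OF that] by (subst nn_integral_realize[OF supp']) auto
    also have "\<dots> = ennreal (plan_loss l p \<beta>)"
      unfolding plan_loss_def using supp l(2)[OF _ that]
      by (intro nn_integral_finite_pmf fin) (auto simp: space_pair_measure)
    finally show ?thesis .
  qed
  ultimately show ?thesis by blast
qed

text \<open>Discretize a nearly optimal coupling by \<open>finite_pmf_with_simple_law\<close>, where \<open>\<kappa>\<close> pairs the source
point with a simple function below the loss. The source point must be a simple function
itself, which is why the first marginal is required to have finite support. The coupling may cost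
up to \<open>(1 + \<eta>) * \<delta>\<close>, as the infimum over couplings is only approached; keeping a fraction \<open>\<eta>\<close> of the
mass in place brings the cost down to \<open>(1 - \<eta>) * (1 + \<eta>) * \<delta> \<le> \<delta>\<close>.\<close>

lemma expected_loss_approx_by_finite_plan:
  fixes \<Omega> :: "'a::t1_space set"
  assumes q: "finite (set_pmf q)" "set_pmf q \<subseteq> \<Omega>" and "0 < \<delta>"
    and c: "\<And>x y. 0 \<le> c x y" "\<And>x. c x x = 0"
      "(\<lambda>z. c (fst z) (snd z)) \<in> borel_measurable (borel_on \<Omega> \<Otimes>\<^sub>M borel_on \<Omega>)"
    and l: "(\<lambda>x. l x \<beta>) \<in> borel_measurable (borel_on \<Omega>)" "\<And>x. x \<in> \<Omega> \<Longrightarrow> 0 \<le> l x \<beta>"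
    and P: "P \<in> uncertainty c \<Omega> \<delta> (realize (borel_on \<Omega>) q)"
    and t: "0 \<le> t" "ennreal t < expected_loss l P \<beta>"
  obtains p where "p \<in> finite_plans c \<Omega> \<delta> q" "t < plan_loss l p \<beta>"
proof -
  let ?N = "borel_on \<Omega>"
  let ?NN = "borel_on \<Omega> \<Otimes>\<^sub>M borel_on \<Omega>"
  define X where "X = set_pmf q"
  obtain t' where t': "t < t'" "ennreal t' < expected_loss l P \<beta>"
  proof -
    obtain e where "ennreal t < e" "e < expected_loss l P \<beta>" using dense[OF t(2)] by blast
    then show ?thesis using that[of "enn2real e"] t(1)
      by (cases e) (auto simp: ennreal_less_iff)
  qed
  \<comment> \<open>chosen so that \<open>(1 - \<eta>) * t'\<close> is the midpoint of \<open>t\<close> and \<open>t'\<close>\<close>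
  define \<eta> where "\<eta> = (1 - t / t') / 2"
  have \<eta>: "0 < \<eta>" "\<eta> < 1" "t < (1 - \<eta>) * t'"
    using t(1) t'(1) by (auto simp: \<eta>_def field_simps)
  have "transport_cost c \<Omega> (realize ?N q) P \<le> ennreal \<delta>"
    using P wasserstein_le_sqrt_iff[of \<delta>] \<open>0 < \<delta>\<close> by (auto simp: uncertainty_def)
  also have "\<dots> < ennreal ((1 + \<eta>) * \<delta>)"
    using \<open>0 < \<delta>\<close> \<eta> by (intro ennreal_lessI) simp_all
  finally obtain \<pi> where \<pi>: "\<pi> \<in> couplings \<Omega> (realize ?N q) P"
    and cost: "(\<integral>\<^sup>+ z. ennreal (c (fst z) (snd z)) \<partial>\<pi>) < ennreal ((1 + \<eta>) * \<delta>)"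
    unfolding transport_cost_def INF_less_iff by blast
  have sets_\<pi> [measurable_cong]: "sets \<pi> = sets ?NN"
    and fst_\<pi>: "distr \<pi> ?N fst = realize ?N q" and snd_\<pi>: "distr \<pi> ?N snd = P"
    and "prob_space \<pi>"
    using \<pi> by (auto simp: couplings_def)
  interpret prob_space \<pi> by fact
  have space_\<pi>: "space \<pi> = \<Omega> \<times> \<Omega>"
    using sets_eq_imp_space_eq[OF sets_\<pi>] by (simp add: space_pair_measure)
  have [measurable]: "fst \<in> \<pi> \<rightarrow>\<^sub>M ?N" "snd \<in> \<pi> \<rightarrow>\<^sub>M ?N"
    by (simp_all add: measurable_cong_sets[OF sets_\<pi> refl])
  have supp: "set_pmf q \<subseteq> space ?N" using q(2) by simp
  have sets_fin: "A \<in> sets ?N" if "A \<subseteq> X" for A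
  proof -
    have "finite A" "A \<subseteq> \<Omega>" using that q finite_subset unfolding X_def by blast+
    then show ?thesis
      using finite_imp_closed[of A] by (auto simp: sets_restrict_space intro!: image_eqI[of _ _ A])
  qed
  obtain a0 where a0: "a0 \<in> X" using set_pmf_not_empty[of q] by (auto simp: X_def)
  \<comment> \<open>a map into the finite set \<open>X\<close> that agrees almost everywhere with the identity\<close>
  define T where "T y = (if y \<in> X then y else a0)" for y
  have XN: "X \<in> sets ?N" by (rule sets_fin) simp
  have T_N: "T \<in> ?N \<rightarrow>\<^sub>M ?N"
    unfolding T_def using XN a0 q(2) by (intro measurable_If_set) (auto simp: X_def Int_absorb2)
  have T_X: "T y \<in> X" for y using a0 by (simp add: T_def)
  define x where "x z = T (fst z)" for z :: "'a \<times> 'a"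
  have x_N [measurable]: "x \<in> \<pi> \<rightarrow>\<^sub>M ?N" unfolding x_def using T_N by measurable
  have x_X: "x z \<in> X" for z by (simp add: x_def T_X)
  have AE_x: "AE z in \<pi>. x z = fst z"
  proof -
    have "AE y in distr \<pi> ?N fst. y \<in> X"
      unfolding fst_\<pi> by (rule AE_realize[OF supp XN]) (simp add: X_def)
    moreover have "{y \<in> space ?N. y \<in> X} = X" using q(2) by (auto simp: X_def)
    ultimately have "AE z in \<pi>. fst z \<in> X"
      by (subst (asm) AE_distr_iff) (use XN in simp_all)
    then show ?thesis by eventually_elim (simp add: x_def T_def)
  qed
  have x_simple: "simple_function \<pi> x"
    unfolding simple_function_def
  proof (intro conjI ballI)
    show "finite (x ` space \<pi>)"
      by (rule finite_subset[OF _ q(1)]) (use x_X in \<open>auto simp: X_def\<close>)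
    fix v assume "v \<in> x ` space \<pi>"
    then have "{v} \<in> sets ?N" using x_X by (intro sets_fin) auto
    then show "x -` {v} \<inter> space \<pi> \<in> sets \<pi>" by (rule measurable_sets[OF x_N])
  qed
  have l_m: "(\<lambda>z. ennreal (l (snd z) \<beta>)) \<in> borel_measurable \<pi>"
    using measurable_compose[OF _ l(1), of snd \<pi>] by simp
  have "expected_loss l P \<beta> = (\<integral>\<^sup>+ z. ennreal (l (snd z) \<beta>) \<partial>\<pi>)"
    unfolding expected_loss_def snd_\<pi>[symmetric] using l(1) by (subst nn_integral_distr) auto
  then have "ennreal t' < (\<integral>\<^sup>+ z. ennreal (l (snd z) \<beta>) \<partial>\<pi>)" using t' by simp
  then obtain g where g: "simple_function \<pi> g" "g \<le> (\<lambda>z. ennreal (l (snd z) \<beta>))"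
    and "ennreal t' < integral\<^sup>S \<pi> g"
    unfolding nn_integral_def less_SUP_iff by blast
  then have g_int: "ennreal t' < (\<integral>\<^sup>+ z. g z \<partial>\<pi>)"
    by (simp add: nn_integral_eq_simple_integral)
  have h_m: "(\<lambda>z. ennreal (c (x z) (snd z))) \<in> borel_measurable \<pi>"
  proof -
    have "(\<lambda>z. (x z, snd z)) \<in> \<pi> \<rightarrow>\<^sub>M ?NN" by measurable
    from measurable_compose[OF this c(3)] show ?thesis by simp
  qed
  obtain p0 where p0: "finite (set_pmf p0)" "set_pmf p0 \<subseteq> space \<pi>"
    and law: "measure_pmf (map_pmf (\<lambda>z. (x z, g z)) p0) = distr \<pi> (count_space UNIV) (\<lambda>z. (x z, g z))"
    and p0_cost: "(\<integral>\<^sup>+ z. ennreal (c (x z) (snd z)) \<partial>measure_pmf p0)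
      \<le> (\<integral>\<^sup>+ z. ennreal (c (x z) (snd z)) \<partial>\<pi>)"
    by (rule finite_pmf_with_simple_law[OF \<open>prob_space \<pi>\<close> simple_function_Pair[OF x_simple g(1)] h_m])
  have xg_m: "(\<lambda>z. (x z, g z)) \<in> \<pi> \<rightarrow>\<^sub>M count_space UNIV"
    by (rule measurable_simple_function[OF simple_function_Pair[OF x_simple g(1)]])
  define p1 where "p1 = map_pmf (\<lambda>z. (x z, snd z)) p0"
  have p1_fin: "finite (set_pmf p1)" using p0 by (simp add: p1_def)
  have p1_supp: "set_pmf p1 \<subseteq> \<Omega> \<times> \<Omega>"
    using p0(2) x_X q(2) by (fastforce simp: p1_def space_\<pi> X_def)
  have "map_pmf fst p1 = q"
  proof (rule pmf_eqI)
    fix v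
    have "ennreal (pmf (map_pmf fst p1) v) = emeasure (measure_pmf (map_pmf (\<lambda>z. (x z, g z)) p0)) (fst -` {v})"
      unfolding emeasure_pmf_single[symmetric] by (simp add: p1_def map_pmf_comp vimage_def)
    also have "\<dots> = emeasure \<pi> (x -` {v} \<inter> space \<pi>)"
      unfolding law by (subst emeasure_distr[OF xg_m]) (auto intro!: arg_cong[where f = "emeasure \<pi>"])
    also have "\<dots> = ennreal (pmf q v)"
    proof (cases "v \<in> X")
      case True
      then have v: "{v} \<in> sets ?N" by (intro sets_fin) auto
      have "emeasure \<pi> (x -` {v} \<inter> space \<pi>) = emeasure \<pi> (fst -` {v} \<inter> space \<pi>)"
        using AE_x v by (intro emeasure_eq_AE) (auto intro: measurable_sets elim: eventually_mono)
      also have "\<dots> = emeasure (realize ?N q) {v}"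
        unfolding fst_\<pi>[symmetric] using v by (subst emeasure_distr) auto
      also have "\<dots> = ennreal (pmf q v)"
        by (simp add: emeasure_realize[OF supp v] emeasure_pmf_single)
      finally show ?thesis .
    next
      case False
      then have "x -` {v} \<inter> space \<pi> = {}" using x_X by auto
      moreover have "pmf q v = 0" using False by (simp add: X_def set_pmf_iff)
      ultimately show ?thesis by simp
    qed
    finally show "pmf (map_pmf fst p1) v = pmf q v" by simp
  qed
  moreover have "measure_pmf.expectation p1 (\<lambda>z. c (fst z) (snd z)) \<le> (1 + \<eta>) * \<delta>"
  proof -
    have "ennreal (measure_pmf.expectation p1 (\<lambda>z. c (fst z) (snd z)))
        = (\<integral>\<^sup>+ z. ennreal (c (x z) (snd z)) \<partial>measure_pmf p0)"
    proof -
      have "ennreal (measure_pmf.expectation p1 (\<lambda>z. c (fst z) (snd z)))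
          = (\<integral>\<^sup>+ z. ennreal (c (fst z) (snd z)) \<partial>measure_pmf p1)"
        using c(1) by (intro nn_integral_finite_pmf[symmetric] p1_fin)
      then show ?thesis by (simp add: p1_def)
    qed
    also have "\<dots> \<le> (\<integral>\<^sup>+ z. ennreal (c (x z) (snd z)) \<partial>\<pi>)" by (rule p0_cost)
    also have "\<dots> = (\<integral>\<^sup>+ z. ennreal (c (fst z) (snd z)) \<partial>\<pi>)"
      using AE_x by (intro nn_integral_cong_AE) (auto elim: eventually_mono)
    also have "\<dots> \<le> ennreal ((1 + \<eta>) * \<delta>)" using cost by simp
    finally show ?thesis using \<eta> \<open>0 < \<delta>\<close> by (simp add: ennreal_le_iff)
  qed
  ultimately have p1: "p1 \<in> finite_plans c \<Omega> ((1 + \<eta>) * \<delta>) q"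
    using p1_fin p1_supp by (simp add: finite_plans_def)
  have p1_loss: "t' < plan_loss l p1 \<beta>"
  proof -
    have "ennreal t' < (\<integral>\<^sup>+ z. g z \<partial>\<pi>)" by (rule g_int)
    also have "\<dots> = (\<integral>\<^sup>+ k. snd k \<partial>distr \<pi> (count_space UNIV) (\<lambda>z. (x z, g z)))"
      by (subst nn_integral_distr[OF xg_m]) auto
    also have "\<dots> = (\<integral>\<^sup>+ z. g z \<partial>measure_pmf p0)"
      unfolding law[symmetric] by simp
    also have "\<dots> \<le> (\<integral>\<^sup>+ z. ennreal (l (snd z) \<beta>) \<partial>measure_pmf p0)"
      using g(2) by (intro nn_integral_mono) (auto simp: le_fun_def)
    also have "\<dots> = (\<integral>\<^sup>+ z. ennreal (l (snd z) \<beta>) \<partial>measure_pmf p1)"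
      by (simp add: p1_def)
    also have "\<dots> = ennreal (plan_loss l p1 \<beta>)"
      unfolding plan_loss_def using p1_supp l(2) by (intro nn_integral_finite_pmf p1_fin) auto
    finally show ?thesis using t(1) t'(1) by (simp add: ennreal_less_iff)
  qed
  define p where "p = mix_pmf (1 - \<eta>) p1 (map_pmf (\<lambda>x. (x, x)) q)"
  have diag: "map_pmf (\<lambda>x. (x, x)) q \<in> finite_plans c \<Omega> 0 q"
    by (rule diagonal_finite_plan[OF q c(2)])
  have \<eta>': "0 \<le> 1 - \<eta>" "1 - \<eta> \<le> 1" using \<eta> by auto
  have "(1 - \<eta>) * ((1 + \<eta>) * \<delta>) + (1 - (1 - \<eta>)) * 0 \<le> \<delta>"
  proof -
    have "(1 - \<eta>) * ((1 + \<eta>) * \<delta>) = \<delta> - \<eta> * \<eta> * \<delta>" by (simp add: algebra_simps)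
    then show ?thesis using \<eta> \<open>0 < \<delta>\<close> by simp
  qed
  with mix_finite_plans(1)[OF \<eta>' p1 diag] have "p \<in> finite_plans c \<Omega> \<delta> q"
    by (auto simp: finite_plans_def p_def)
  moreover have "t < plan_loss l p \<beta>"
  proof -
    have "t < (1 - \<eta>) * t'" by (rule \<eta>)
    also have "\<dots> \<le> (1 - \<eta>) * plan_loss l p1 \<beta>"
      using p1_loss \<eta> by (intro mult_left_mono) auto
    also have "\<dots> \<le> plan_loss l p \<beta>"
      unfolding p_def mix_finite_plans(2)[OF \<eta>' p1 diag]
      using plan_loss_nonneg[of _ _ _ _ _ l \<beta>, OF diag l(2)] \<eta> by simp
    finally show ?thesis .
  qed
  ultimately show ?thesis by (rule that)
qed

text \<open>Send a fraction \<open>\<epsilon>\<close> of the mass, regardless of its origin, to the uniform distribution on \<open>J\<close>.\<close>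

lemma coercive_finite_plan:
  assumes q: "finite (set_pmf q)" "set_pmf q \<subseteq> \<Omega>" and "0 < \<delta>"
    and c: "\<And>x y. 0 \<le> c x y" "\<And>x. c x x = 0"
    and l: "\<And>x \<beta>. x \<in> \<Omega> \<Longrightarrow> \<beta> \<in> B \<Longrightarrow> 0 \<le> l x \<beta>"
    and J: "finite J" "J \<noteq> {}" "J \<subseteq> \<Omega>" "\<And>s. bounded {\<beta>\<in>B. \<forall>x\<in>J. l x \<beta> \<le> (s::real)}"
  obtains p where "p \<in> finite_plans c \<Omega> \<delta> q" "\<And>s. bounded {\<beta>\<in>B. plan_loss l p \<beta> \<le> s}"
proof -
  define p1 where "p1 = pair_pmf q (pmf_of_set J)"
  define C where "C = measure_pmf.expectation p1 (\<lambda>z. c (fst z) (snd z))"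
  have "0 \<le> C" unfolding C_def using c(1) by (intro expectation_pmf_nonneg)
  have p1: "p1 \<in> finite_plans c \<Omega> C q"
    using q J by (auto simp: finite_plans_def p1_def C_def map_fst_pair_pmf)
  \<comment> \<open>a fraction in \<open>]0, 1]\<close> with \<open>\<epsilon> * C \<le> \<delta>\<close>\<close>
  define \<epsilon> where "\<epsilon> = \<delta> / (C + \<delta>)"
  have \<epsilon>: "0 < \<epsilon>" "0 \<le> \<epsilon>" "\<epsilon> \<le> 1" using \<open>0 \<le> C\<close> \<open>0 < \<delta>\<close> by (auto simp: \<epsilon>_def)
  have diag: "map_pmf (\<lambda>x. (x, x)) q \<in> finite_plans c \<Omega> 0 q"
    by (rule diagonal_finite_plan[OF q c(2)])
  define p where "p = mix_pmf \<epsilon> p1 (map_pmf (\<lambda>x. (x, x)) q)"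
  have "\<epsilon> * C + (1 - \<epsilon>) * 0 \<le> \<delta>"
    using \<open>0 \<le> C\<close> \<open>0 < \<delta>\<close> by (simp add: \<epsilon>_def field_simps)
  with mix_finite_plans(1)[OF \<epsilon>(2,3) p1 diag] have "p \<in> finite_plans c \<Omega> \<delta> q"
    by (auto simp: finite_plans_def p_def)
  moreover have "bounded {\<beta>\<in>B. plan_loss l p \<beta> \<le> s}" for s
  proof (rule bounded_subset[OF J(4)[of "s * card J / \<epsilon>"]], safe)
    fix \<beta> x assume \<beta>: "\<beta> \<in> B" "plan_loss l p \<beta> \<le> s" and x: "x \<in> J"
    have nn: "0 \<le> l y \<beta>" if "y \<in> J" for y using l[of y \<beta>] \<beta>(1) J(3) that by blast
    have "l x \<beta> \<le> (\<Sum>y\<in>J. l y \<beta>)"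
      using J(1) x nn by (intro member_le_sum) auto
    also have "\<dots> = plan_loss l p1 \<beta> * card J"
    proof -
      have "plan_loss l p1 \<beta> = measure_pmf.expectation (map_pmf snd p1) (\<lambda>y. l y \<beta>)"
        by (simp add: plan_loss_def)
      also have "\<dots> = (\<Sum>y\<in>J. l y \<beta>) / card J"
        by (simp only: p1_def map_snd_pair_pmf integral_pmf_of_set[OF J(2,1)])
      finally show ?thesis using J(1,2) by simp
    qed
    also have "\<dots> \<le> s / \<epsilon> * card J"
    proof (rule mult_right_mono)
      have "\<epsilon> * plan_loss l p1 \<beta> \<le> plan_loss l p \<beta>"
        unfolding p_def mix_finite_plans(2)[OF \<epsilon>(2,3) p1 diag]
        using plan_loss_nonneg[of _ _ _ _ _ l \<beta>, OF diag l[OF _ \<beta>(1)]] \<epsilon> by simp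
      then show "plan_loss l p1 \<beta> \<le> s / \<epsilon>" using \<beta>(2) \<epsilon>(1) by (simp add: field_simps)
    qed simp
    finally show "l x \<beta> \<le> s * card J / \<epsilon>" by simp
  qed
  ultimately show ?thesis by (rule that)
qed

section \<open>Minimax and compatible minimizers\<close>

lemma uncertainty_mono:
  "0 \<le> \<delta> \<Longrightarrow> \<delta> \<le> \<delta>' \<Longrightarrow> uncertainty c \<Omega> \<delta> Q \<subseteq> uncertainty c \<Omega> \<delta>' Q"
  by (auto simp: uncertainty_def intro: order_trans ennreal_leI)

text \<open>This inclusion lets the minimax argument work at the exact radius \<open>\<delta>\<close>, without enlarging it.\<close>

lemma closure_compatible_estimators_subset_plus:
  assumes "0 \<le> \<delta>"
  shows "closure (compatible_estimators c \<Omega> l B \<delta> Q) \<subseteq> compatible_estimators_plus c \<Omega> l B \<delta> Q"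
  unfolding compatible_estimators_plus_def
proof (intro closure_mono INT_greatest)
  fix \<epsilon> :: real assume "\<epsilon> \<in> {0<..}"
  then show "compatible_estimators c \<Omega> l B \<delta> Q \<subseteq> compatible_estimators c \<Omega> l B (\<delta> + \<epsilon>) Q"
    using uncertainty_mono[OF assms, of "\<delta> + \<epsilon>" c \<Omega> Q] by (auto simp: compatible_estimators_def)
qed

lemma argmin_on_iff:
  fixes f :: "'b \<Rightarrow> 'c::linorder"
  shows "\<beta> \<in> argmin_on B f \<longleftrightarrow> \<beta> \<in> B \<and> (\<forall>b\<in>B. f \<beta> \<le> f b)"
  by (auto simp: argmin_on_def is_arg_min_linorder)

text \<open>The minimax theorem for an arbitrary non-negative measurable cost vanishing on the diagonal and a reference
measure with finite support. The growth condition on \<open>\<beta>0\<close> provides the coercive plan.\<close>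

theorem wasserstein_minimax:
  fixes \<Omega> :: "'a::t1_space set" and B :: "'b::euclidean_space set"
  defines "N \<equiv> borel_on \<Omega>"
  assumes q: "finite (set_pmf q)" "set_pmf q \<subseteq> \<Omega>" and "0 < \<delta>"
    and c: "\<And>x y. 0 \<le> c x y" "\<And>x. c x x = 0"
      "(\<lambda>z. c (fst z) (snd z)) \<in> borel_measurable (N \<Otimes>\<^sub>M N)"
    and B: "closed B" "\<beta>0 \<in> B"
    and l: "\<And>\<beta>. \<beta> \<in> B \<Longrightarrow> (\<lambda>x. l x \<beta>) \<in> borel_measurable N"
      "\<And>x \<beta>. x \<in> \<Omega> \<Longrightarrow> \<beta> \<in> B \<Longrightarrow> 0 \<le> l x \<beta>"
      "\<And>x. x \<in> \<Omega> \<Longrightarrow> continuous_on B (l x)"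
      "\<And>x. x \<in> \<Omega> \<Longrightarrow> convex_on B (l x)"
      "\<And>\<beta>. \<beta> \<in> B \<Longrightarrow> \<beta> \<noteq> \<beta>0 \<Longrightarrow> \<exists>x\<in>\<Omega>. l x \<beta>0 < l x \<beta>"
  defines "U \<equiv> uncertainty c \<Omega> \<delta> (realize N q)"
  shows "(INF \<beta>\<in>B. SUP P\<in>U. expected_loss l P \<beta>) = (SUP P\<in>U. INF \<beta>\<in>B. expected_loss l P \<beta>)"
    and "\<exists>\<beta>. \<beta> \<in> argmin_on B (robust_loss c \<Omega> l \<delta> (realize N q))
      \<and> \<beta> \<in> closure (compatible_estimators c \<Omega> l B \<delta> (realize N q))"
proof -
  let ?\<P> = "finite_plans c \<Omega> \<delta> q"
  define g where "g = robust_loss c \<Omega> l \<delta> (realize N q)"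
  define \<Lambda> where "\<Lambda> = compatible_estimators c \<Omega> l B \<delta> (realize N q)"
  have g: "g \<beta> = (SUP P\<in>U. expected_loss l P \<beta>)" for \<beta>
    by (simp add: g_def robust_loss_def U_def)
  have "\<Omega> \<noteq> {}" using q(2) set_pmf_not_empty[of q] by blast
  then have "convex B" using l(4) by (auto simp: convex_on_def)
  have plan_U: "\<exists>P\<in>U. \<forall>\<beta>\<in>B. expected_loss l P \<beta> = ennreal (plan_loss l p \<beta>)" if p: "p \<in> ?\<P>" for p
    unfolding U_def N_def
    by (rule finite_plan_realizes_uncertain_dist[OF p less_imp_le[OF \<open>0 < \<delta>\<close>] c(1)
          c(3)[unfolded N_def] l(1)[unfolded N_def] l(2)])
  have U_plan: "\<exists>p\<in>?\<P>. t < plan_loss l p \<beta>" if "\<beta> \<in> B" "0 \<le> t" "ennreal t < g \<beta>" for t \<beta>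
  proof -
    obtain P where P: "P \<in> U" "ennreal t < expected_loss l P \<beta>"
      using \<open>ennreal t < g \<beta>\<close> unfolding g less_SUP_iff by blast
    obtain p where "p \<in> ?\<P>" "t < plan_loss l p \<beta>"
      by (rule expected_loss_approx_by_finite_plan[OF q \<open>0 < \<delta>\<close> c(1,2) c(3)[unfolded N_def]
            l(1)[unfolded N_def, OF \<open>\<beta> \<in> B\<close>] l(2)[OF _ \<open>\<beta> \<in> B\<close>] P(1)[unfolded U_def N_def]
            \<open>0 \<le> t\<close> P(2)])
    then show ?thesis by blast
  qed
  obtain J where J: "finite J" "J \<noteq> {}" "J \<subseteq> \<Omega>" "\<And>s. bounded {\<beta>\<in>B. \<forall>x\<in>J. l x \<beta> \<le> s}"
    using finite_coercive_subfamily[where f = l, OF B l(4,3,2,5) \<open>\<Omega> \<noteq> {}\<close>] by blast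
  obtain p0 where p0: "p0 \<in> ?\<P>" "\<And>s. bounded {\<beta>\<in>B. plan_loss l p0 \<beta> \<le> s}"
    using coercive_finite_plan[where c = c and l = l and B = B, OF q \<open>0 < \<delta>\<close> c(1,2) l(2) J] by blast
  have mix: "\<exists>r\<in>?\<P>. \<forall>\<beta>\<in>B. plan_loss l r \<beta> = u * plan_loss l p \<beta> + (1 - u) * plan_loss l p' \<beta>"
    if "p \<in> ?\<P>" "p' \<in> ?\<P>" "0 \<le> u" "u \<le> 1" for p p' u
  proof (intro bexI[of _ "mix_pmf u p p'"] ballI)
    have "u * \<delta> + (1 - u) * \<delta> = \<delta>" by (simp add: algebra_simps)
    then show "mix_pmf u p p' \<in> ?\<P>" using mix_finite_plans(1)[OF that(3,4,1,2)] by simp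
  qed (rule mix_finite_plans(2)[OF that(3,4,1,2)])
  have cvx: "convex_on B (plan_loss l p)" if "p \<in> ?\<P>" for p
    using that l(4) by (rule convex_on_plan_loss)
  have cont: "continuous_on B (plan_loss l p)" if "p \<in> ?\<P>" for p
    using that l(3) by (rule continuous_on_plan_loss)
  \<comment> \<open>\<open>saddle_point_selection\<close>, stated for the distributions in \<open>U\<close> instead of the plans\<close>
  have saddle: "\<exists>P\<in>U. \<exists>\<beta>. \<beta> \<in> argmin_on B (expected_loss l P) \<and> (\<beta> \<in> G \<or> ennreal t < expected_loss l P \<beta>)"
    if t: "0 \<le> t" and G: "open G" "\<And>\<beta>. \<beta> \<in> B - G \<Longrightarrow> ennreal t < g \<beta>" for t G
  proof -
    have "B \<noteq> {}" using B by blast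
    have out: "\<exists>p\<in>?\<P>. t < plan_loss l p \<beta>" if "\<beta> \<in> B - G" for \<beta>
      using U_plan[OF _ t G(2)] that by blast
    obtain r \<beta> where r: "r \<in> ?\<P>" "\<beta> \<in> B"
      "\<And>b. b \<in> B \<Longrightarrow> plan_loss l r \<beta> \<le> plan_loss l r b" "\<beta> \<in> G \<or> t < plan_loss l r \<beta>"
      using saddle_point_selection[where \<phi> = "plan_loss l", OF B(1) \<open>convex B\<close> \<open>B \<noteq> {}\<close> cvx cont mix p0
          G(1) out] by blast
    obtain P where P: "P \<in> U" "\<And>b. b \<in> B \<Longrightarrow> expected_loss l P b = ennreal (plan_loss l r b)"
      using plan_U[OF r(1)] by blast
    have "\<beta> \<in> argmin_on B (expected_loss l P)"
      using r(2,3) P(2) by (simp add: argmin_on_iff ennreal_leI)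
    moreover have "\<beta> \<in> G \<or> ennreal t < expected_loss l P \<beta>"
      using r(2,4) P(2) t by (auto simp: ennreal_less_iff)
    ultimately show ?thesis using P(1) by blast
  qed
  show "(INF \<beta>\<in>B. SUP P\<in>U. expected_loss l P \<beta>) = (SUP P\<in>U. INF \<beta>\<in>B. expected_loss l P \<beta>)"
  proof (rule antisym)
    show "(SUP P\<in>U. INF \<beta>\<in>B. expected_loss l P \<beta>) \<le> (INF \<beta>\<in>B. SUP P\<in>U. expected_loss l P \<beta>)"
      by (intro SUP_least INF_greatest) (meson INF_lower SUP_upper order_trans)
    show "(INF \<beta>\<in>B. SUP P\<in>U. expected_loss l P \<beta>) \<le> (SUP P\<in>U. INF \<beta>\<in>B. expected_loss l P \<beta>)"
    proof (rule dense_le)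
      fix y assume y: "y < (INF \<beta>\<in>B. SUP P\<in>U. expected_loss l P \<beta>)"
      then obtain t where t: "0 \<le> t" "y = ennreal t" by (cases y) auto
      have "ennreal t < g \<beta>" if "\<beta> \<in> B - {}" for \<beta>
        using y that unfolding t(2) g by (meson DiffD1 INF_lower less_le_trans)
      then obtain P \<beta> where P: "P \<in> U" "\<beta> \<in> argmin_on B (expected_loss l P)" "ennreal t < expected_loss l P \<beta>"
        using saddle[OF t(1) open_empty] by blast
      have "y \<le> (INF \<beta>\<in>B. expected_loss l P \<beta>)"
        using P(2,3) t(2) by (intro INF_greatest) (auto simp: argmin_on_iff)
      also have "\<dots> \<le> (SUP P\<in>U. INF \<beta>\<in>B. expected_loss l P \<beta>)" using P(1) by (rule SUP_upper)
      finally show "y \<le> (SUP P\<in>U. INF \<beta>\<in>B. expected_loss l P \<beta>)" .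
    qed
  qed
  have in_\<Lambda>: "\<beta> \<in> closure \<Lambda>" if "P \<in> U" "\<beta> \<in> argmin_on B (expected_loss l P)" for P \<beta>
    using that by (intro closure_subset[THEN subsetD]) (auto simp: \<Lambda>_def compatible_estimators_def U_def argmin_on_iff)
  show "\<exists>\<beta>. \<beta> \<in> argmin_on B (robust_loss c \<Omega> l \<delta> (realize N q))
      \<and> \<beta> \<in> closure (compatible_estimators c \<Omega> l B \<delta> (realize N q))"
    unfolding g_def[symmetric] \<Lambda>_def[symmetric]
  proof (cases "INF \<beta>\<in>B. g \<beta>")
    case top
    then have top': "g \<beta> = \<infinity>" if "\<beta> \<in> B" for \<beta>
      using INF_lower[of \<beta> B g] that by (simp add: top_unique)
    obtain P \<beta> where P: "P \<in> U" "\<beta> \<in> argmin_on B (expected_loss l P)"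
      using saddle[of 0 UNIV] by auto
    then have "\<beta> \<in> argmin_on B g" using top' by (auto simp: argmin_on_iff)
    then show "\<exists>\<beta>. \<beta> \<in> argmin_on B g \<and> \<beta> \<in> closure \<Lambda>" using in_\<Lambda>[OF P] by blast
  next
    case (real v)
    show "\<exists>\<beta>. \<beta> \<in> argmin_on B g \<and> \<beta> \<in> closure \<Lambda>"
    proof (rule ccontr)
      assume none: "\<not> ?thesis"
      \<comment> \<open>By \<open>none\<close> no point of \<open>closure \<Lambda>\<close> is optimal, so the selected minimizer has a value above the infimum.\<close>
      have "ennreal v < g \<beta>" if \<beta>: "\<beta> \<in> B - (- closure \<Lambda>)" for \<beta>
      proof -
        have "\<beta> \<notin> argmin_on B g" using none \<beta> by blast
        then obtain b where "b \<in> B" "g b < g \<beta>" using \<beta> by (auto simp: argmin_on_iff not_le)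
        then show ?thesis using INF_lower[of b B g] real(2) by simp
      qed
      then obtain P \<beta> where P: "P \<in> U" "\<beta> \<in> argmin_on B (expected_loss l P)"
        "\<beta> \<in> - closure \<Lambda> \<or> ennreal v < expected_loss l P \<beta>"
        using saddle[of v "- closure \<Lambda>"] real(1) by (auto simp: open_Compl)
      then have "ennreal v < expected_loss l P \<beta>" using in_\<Lambda>[OF P(1,2)] by blast
      also have "\<dots> \<le> (INF b\<in>B. g b)"
      proof (rule INF_greatest)
        fix b assume "b \<in> B"
        then have "expected_loss l P \<beta> \<le> expected_loss l P b" using P(2) by (simp add: argmin_on_iff)
        also have "\<dots> \<le> g b" unfolding g using P(1) by (rule SUP_upper)
        finally show "expected_loss l P \<beta> \<le> g b" .
      qed
      finally show False using real(2) by simp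
    qed
  qed
qed

section \<open>Empirical measures and norm costs\<close>

lemma empirical_measure_eq_realize:
  assumes n: "1 \<le> n" and x: "\<And>i. i \<in> {1..n} \<Longrightarrow> x i \<in> \<Omega>"
  shows "empirical_measure \<Omega> n x = realize (borel_on \<Omega>) (map_pmf x (pmf_of_set {1..n}))"
proof (rule measure_eqI)
  fix A assume "A \<in> sets (empirical_measure \<Omega> n x)"
  then have A: "A \<in> sets (borel_on \<Omega>)" by simp
  have ne: "{1..n} \<noteq> {}" using n by simp
  have supp: "set_pmf (map_pmf x (pmf_of_set {1..n})) \<subseteq> space (borel_on \<Omega>)"
    using x ne by auto
  have "emeasure (empirical_measure \<Omega> n x) A = (\<Sum>i\<in>{1..n}. indicator A (x i)) / of_nat n"
    using A by (simp add: emeasure_empirical_measure)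
  also have "\<dots> = (\<integral>\<^sup>+ i. indicator A (x i) \<partial>measure_pmf (pmf_of_set {1..n}))"
    using ne by (subst nn_integral_pmf_of_set) (auto simp: ennreal_of_nat_eq_real_of_nat)
  also have "\<dots> = (\<integral>\<^sup>+ y. indicator A y \<partial>measure_pmf (map_pmf x (pmf_of_set {1..n})))"
    by (simp only: nn_integral_map_pmf)
  also have "\<dots> = emeasure (realize (borel_on \<Omega>) (map_pmf x (pmf_of_set {1..n}))) A"
    unfolding emeasure_realize[OF supp A] by (rule nn_integral_indicator) simp
  finally show "emeasure (empirical_measure \<Omega> n x) A
    = emeasure (realize (borel_on \<Omega>) (map_pmf x (pmf_of_set {1..n}))) A" .
qed simp

lemma lq_norm_zero [simp]: "lq_norm q 0 = 0"
  by (simp add: lq_norm_def infnorm_0)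

lemma borel_measurable_lq_norm: "(lq_norm q :: real ^ 'm \<Rightarrow> real) \<in> borel_measurable borel"
proof (cases "q = \<infinity>")
  case True
  then have "(lq_norm q :: real ^ 'm \<Rightarrow> real) = infnorm" by (auto simp: lq_norm_def)
  moreover have "continuous_on UNIV (\<lambda>u::real ^ 'm. infnorm u)" by (intro continuous_intros)
  ultimately show ?thesis by (simp add: borel_measurable_continuous_onI)
next
  case False
  have [measurable]: "(\<lambda>u::real ^ 'm. u $ i) \<in> borel_measurable borel" for i
    by (intro borel_measurable_continuous_onI continuous_intros)
  have "(lq_norm q :: real ^ 'm \<Rightarrow> real) = (\<lambda>u. (\<Sum>i\<in>UNIV. \<bar>u $ i\<bar> powr real_of_ereal q) powr (1 / real_of_ereal q))"
    using False by (auto simp: lq_norm_def)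
  then show ?thesis by simp
qed

text \<open>A competitor nowhere worse than \<open>\<beta>0\<close> would have no larger expectation and tie for the minimum.\<close>

lemma unique_minimizer_beaten_pointwise:
  assumes min: "argmin_on B (expected_loss l P) = {\<beta>0}" and \<beta>: "\<beta> \<in> B" "\<beta> \<noteq> \<beta>0"
  shows "\<exists>x\<in>space P. l x \<beta>0 < l x \<beta>"
proof (rule ccontr)
  assume "\<not> ?thesis"
  then have "expected_loss l P \<beta> \<le> expected_loss l P \<beta>0"
    unfolding expected_loss_def by (intro nn_integral_mono ennreal_leI) (auto simp: not_less)
  moreover have "\<beta>0 \<in> argmin_on B (expected_loss l P)" using min by simp
  ultimately have "\<beta> \<in> argmin_on B (expected_loss l P)"
    using \<beta>(1) by (auto simp: argmin_on_iff intro: order_trans)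
  then show False using min \<beta>(2) by simp
qed

theorem theorem2:
  fixes \<Omega> :: "(real ^ 'm) set"
    and B :: "(real ^ 'd) set"
    and q :: ereal
    and c :: "real ^ 'm \<Rightarrow> real ^ 'm \<Rightarrow> real"
    and l :: "real ^ 'm \<Rightarrow> real ^ 'd \<Rightarrow> real"
    and Pstar :: "(real ^ 'm) measure"
    and \<beta>star :: "real ^ 'd"
    and M :: "'w measure"
    and X :: "nat \<Rightarrow> 'w \<Rightarrow> real ^ 'm"
    and n :: nat
    and \<delta> :: real
  assumes "closed \<Omega>"
    and "closed B" and "convex B"
    and "1 \<le> q"
    and "\<And>u w. c u w = (lq_norm q (u - w))\<^sup>2"
    and "continuous_on (\<Omega> \<times> B) (\<lambda>(x, \<beta>). l x \<beta>)"
    and "\<And>x \<beta>. x \<in> \<Omega> \<Longrightarrow> \<beta> \<in> B \<Longrightarrow> 0 \<le> l x \<beta>"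
    and "\<And>x. x \<in> \<Omega> \<Longrightarrow> convex_on B (l x)"
    and "Pstar \<in> prob_dists \<Omega>"
    and "argmin_on B (expected_loss l Pstar) = {\<beta>star}"
    and "\<beta>star \<in> interior B"
    and "prob_space M"
    and "prob_space.indep_vars M (\<lambda>_. borel_on \<Omega>) X {1..n}"
    and "\<And>i. i \<in> {1..n} \<Longrightarrow> distr M (borel_on \<Omega>) (X i) = Pstar"
    and "1 \<le> n"
    and "\<delta> > 0"
  shows "\<forall>\<omega>\<in>space M.
    (let Pn = empirical_measure \<Omega> n (\<lambda>i. X i \<omega>) in
      (INF \<beta>\<in>B. SUP P\<in>uncertainty c \<Omega> \<delta> Pn. expected_loss l P \<beta>)
        = (SUP P\<in>uncertainty c \<Omega> \<delta> Pn. INF \<beta>\<in>B. expected_loss l P \<beta>)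
      \<and> (\<exists>\<beta>DRO. \<beta>DRO \<in> argmin_on B (robust_loss c \<Omega> l \<delta> Pn)
            \<and> \<beta>DRO \<in> compatible_estimators_plus c \<Omega> l B \<delta> Pn))"
proof
  fix \<omega> assume \<omega>: "\<omega> \<in> space M"
  interpret prob_space M by fact
  define q0 where "q0 = map_pmf (\<lambda>i. X i \<omega>) (pmf_of_set {1..n})"
  have X: "X i \<omega> \<in> \<Omega>" if "i \<in> {1..n}" for i
  proof -
    have "X i \<in> M \<rightarrow>\<^sub>M borel_on \<Omega>" using assms(13) that by (auto simp: indep_vars_def)
    from measurable_space[OF this \<omega>] show ?thesis by simp
  qed
  have "{1..n} \<noteq> {}" using \<open>1 \<le> n\<close> by simp
  then have q0: "finite (set_pmf q0)" "set_pmf q0 \<subseteq> \<Omega>"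
    using X by (auto simp: q0_def)
  have Pn: "empirical_measure \<Omega> n (\<lambda>i. X i \<omega>) = realize (borel_on \<Omega>) q0"
    unfolding q0_def using \<open>1 \<le> n\<close> X by (rule empirical_measure_eq_realize)
  have c_meas: "(\<lambda>z. c (fst z) (snd z)) \<in> borel_measurable (borel_on \<Omega> \<Otimes>\<^sub>M borel_on \<Omega>)"
  proof -
    have id: "(\<lambda>x. x) \<in> borel_on \<Omega> \<rightarrow>\<^sub>M borel" by (rule measurable_restrict_space1) simp
    have "(\<lambda>z. fst z - snd z) \<in> borel_on \<Omega> \<Otimes>\<^sub>M borel_on \<Omega> \<rightarrow>\<^sub>M borel"
      by (intro borel_measurable_diff measurable_compose[OF measurable_fst id]
          measurable_compose[OF measurable_snd id])
    from measurable_compose[OF this borel_measurable_lq_norm[of q]] show ?thesis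
      unfolding assms(5) by (rule borel_measurable_power)
  qed
  have l_meas: "(\<lambda>x. l x \<beta>) \<in> borel_measurable (borel_on \<Omega>)" if "\<beta> \<in> B" for \<beta>
  proof (rule borel_measurable_continuous_on_restrict)
    have "continuous_on \<Omega> ((\<lambda>(x, \<beta>). l x \<beta>) \<circ> (\<lambda>x. (x, \<beta>)))"
      using that by (intro continuous_on_compose continuous_intros continuous_on_subset[OF assms(6)]) auto
    then show "continuous_on \<Omega> (\<lambda>x. l x \<beta>)" by (simp add: comp_def)
  qed
  have l_cont: "continuous_on B (l x)" if "x \<in> \<Omega>" for x
  proof -
    have "continuous_on B ((\<lambda>(x, \<beta>). l x \<beta>) \<circ> (\<lambda>\<beta>. (x, \<beta>)))"
      using that by (intro continuous_on_compose continuous_intros continuous_on_subset[OF assms(6)]) auto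
    then show ?thesis by (simp add: comp_def)
  qed
  have "space Pstar = \<Omega>"
    using assms(9) sets_eq_imp_space_eq[of Pstar "borel_on \<Omega>"] by (simp add: prob_dists_def)
  then have beaten: "\<exists>x\<in>\<Omega>. l x \<beta>star < l x \<beta>" if "\<beta> \<in> B" "\<beta> \<noteq> \<beta>star" for \<beta>
    using unique_minimizer_beaten_pointwise[OF assms(10) that] by simp
  have "\<beta>star \<in> B" using assms(11) interior_subset by blast
  have c: "0 \<le> c x y" "c x x = 0" for x y by (simp_all add: assms(5))
  note minimax = wasserstein_minimax[OF q0 \<open>0 < \<delta>\<close> c c_meas \<open>closed B\<close> \<open>\<beta>star \<in> B\<close>
      l_meas assms(7) l_cont assms(8) beaten, folded Pn]
  show "let Pn = empirical_measure \<Omega> n (\<lambda>i. X i \<omega>) in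
      (INF \<beta>\<in>B. SUP P\<in>uncertainty c \<Omega> \<delta> Pn. expected_loss l P \<beta>)
        = (SUP P\<in>uncertainty c \<Omega> \<delta> Pn. INF \<beta>\<in>B. expected_loss l P \<beta>)
      \<and> (\<exists>\<beta>DRO. \<beta>DRO \<in> argmin_on B (robust_loss c \<Omega> l \<delta> Pn)
            \<and> \<beta>DRO \<in> compatible_estimators_plus c \<Omega> l B \<delta> Pn)"
    unfolding Let_def
    using minimax closure_compatible_estimators_subset_plus[of \<delta> c \<Omega> l B] \<open>0 < \<delta>\<close> by (blast intro: less_imp_le)
qed

end
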